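(* Let $H$ be an infinite-dimensional complex Hilbert space and let $\mathcal{G}_{\infty}(H)$ be the set of all closed subspaces of $H$ whose dimension and codimension are both infinite. Let $f:\mathcal{G}_{\infty}(H)\to\mathcal{G}_{\infty}(H)$ be a (not necessarily surjective) map sending every pair of subspaces to an equivalent pair of subspaces, i.e. for all $X,Y\in\mathcal{G}_{\infty}(H)$ there is a linear isometry $L_{\{X,Y\}}:H\to H$ with $\{f(X),f(Y)\}=\{L_{\{X,Y\}}(X),L_{\{X,Y\}}(Y)\}$. Then there is a linear or conjugate linear isometry $L:H\to H$, unique up to a scalar multiple, and for every $X\in\mathcal{G}_{\infty}(H)$ a closed subspace $O(X)$ orthogonal to the range of $L$, such that $$f(X)=L(X)\oplus O(X)\quad\text{for all }X\in\mathcal{G}_{\infty}(H).$$ Moreover, if $X,Y$ belong to the same component of $\mathcal{G}_{\infty}(H)$, then $O(X)=O(Y)$; and if $X,Y\in\mathcal{G}_{\infty}(H)$ with $Y\subset X$, then $O(Y)\subset O(X)$.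
   Context: A linear isometry $H\to H$ is a norm-preserving linear map (not necessarily surjective); a conjugate linear isometry is a norm-preserving conjugate linear map. Two pairs of closed subspaces are equivalent if some linear isometry of $H$ transfers one pair (as an unordered pair) to the other. A component of $\mathcal{G}_{\infty}(H)$ is a subset $\mathcal{C}$ maximal with respect to the property that $\operatorname{codim}_X(X\cap Y)<\infty$ and $\operatorname{codim}_Y(X\cap Y)<\infty$ for all $X,Y\in\mathcal{C}$; the component containing $X$ consists of all $Y\in\mathcal{G}_{\infty}(H)$ satisfying these two finiteness conditions with $X$. *)

theory Defs
  imports "HOL-Analysis.Analysis"
begin

text \<open>A complex Hilbert space is modelled as a real Hilbert space (real inner product,
  complete) together with a complex scalar multiplication extending the real one and
  satisfying the norm homogeneity law.  The complex inner product is then recovered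
  as cinner below (linear in the first, conjugate linear in the second argument).\<close>

class complex_hilbert = real_inner + complete_space +
  fixes scaleC :: "complex \<Rightarrow> 'a \<Rightarrow> 'a"
  assumes scaleC_add_right: "scaleC a (x + y) = scaleC a x + scaleC a y"
    and scaleC_add_left: "scaleC (a + b) x = scaleC a x + scaleC b x"
    and scaleC_scaleC: "scaleC a (scaleC b x) = scaleC (a * b) x"
    and scaleC_of_real: "scaleC (of_real r) x = scaleR r x"
    and norm_scaleC: "norm (scaleC a x) = cmod a * norm x"

definition cinner :: "'a::complex_hilbert \<Rightarrow> 'a \<Rightarrow> complex" where
  "cinner x y = Complex (inner x y) (inner x (scaleC \<i> y))"

definition csubspace :: "'a::complex_hilbert set \<Rightarrow> bool" where
  "csubspace S \<longleftrightarrow> 0 \<in> S \<and> (\<forall>x\<in>S. \<forall>y\<in>S. x + y \<in> S) \<and> (\<forall>a. \<forall>x\<in>S. scaleC a x \<in> S)"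

definition closed_csubspace :: "'a::complex_hilbert set \<Rightarrow> bool" where
  "closed_csubspace S \<longleftrightarrow> csubspace S \<and> closed S"

definition orth_compl :: "'a::complex_hilbert set \<Rightarrow> 'a set" where
  "orth_compl S = {y. \<forall>x\<in>S. cinner x y = 0}"

definition cdependent :: "'a::complex_hilbert set \<Rightarrow> bool" where
  "cdependent A \<longleftrightarrow> (\<exists>T u. finite T \<and> T \<subseteq> A \<and> (\<Sum>v\<in>T. scaleC (u v) v) = 0 \<and> (\<exists>v\<in>T. u v \<noteq> 0))"

definition infinite_cdim :: "'a::complex_hilbert set \<Rightarrow> bool" where
  "infinite_cdim S \<longleftrightarrow> (\<exists>A. A \<subseteq> S \<and> infinite A \<and> \<not> cdependent A)"

definition G_inf :: "'a::complex_hilbert set set" where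
  "G_inf = {X. closed_csubspace X \<and> infinite_cdim X \<and> infinite_cdim (orth_compl X)}"

definition finite_codim_in :: "'a::complex_hilbert set \<Rightarrow> 'a set \<Rightarrow> bool" where
  "finite_codim_in Z X \<longleftrightarrow> \<not> infinite_cdim (X \<inter> orth_compl Z)"

definition same_component :: "'a::complex_hilbert set \<Rightarrow> 'a set \<Rightarrow> bool" where
  "same_component X Y \<longleftrightarrow> finite_codim_in (X \<inter> Y) X \<and> finite_codim_in (X \<inter> Y) Y"

definition clinear_map :: "('a::complex_hilbert \<Rightarrow> 'a) \<Rightarrow> bool" where
  "clinear_map L \<longleftrightarrow> (\<forall>x y. L (x + y) = L x + L y) \<and> (\<forall>a x. L (scaleC a x) = scaleC a (L x))"

definition cconj_linear_map :: "('a::complex_hilbert \<Rightarrow> 'a) \<Rightarrow> bool" where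
  "cconj_linear_map L \<longleftrightarrow> (\<forall>x y. L (x + y) = L x + L y) \<and> (\<forall>a x. L (scaleC a x) = scaleC (cnj a) (L x))"

definition linear_isometry :: "('a::complex_hilbert \<Rightarrow> 'a) \<Rightarrow> bool" where
  "linear_isometry L \<longleftrightarrow> clinear_map L \<and> (\<forall>x. norm (L x) = norm x)"

definition conj_linear_isometry :: "('a::complex_hilbert \<Rightarrow> 'a) \<Rightarrow> bool" where
  "conj_linear_isometry L \<longleftrightarrow> cconj_linear_map L \<and> (\<forall>x. norm (L x) = norm x)"

definition preserves_pair_equivalence :: "('a::complex_hilbert set \<Rightarrow> 'a set) \<Rightarrow> bool" where
  "preserves_pair_equivalence f \<longleftrightarrow>
     (\<forall>X\<in>G_inf. \<forall>Y\<in>G_inf. \<exists>L. linear_isometry L \<and> {f X, f Y} = {L ` X, L ` Y})"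

definition represents :: "('a::complex_hilbert set \<Rightarrow> 'a set) \<Rightarrow> ('a \<Rightarrow> 'a) \<Rightarrow> ('a set \<Rightarrow> 'a set) \<Rightarrow> bool" where
  "represents f L Ofn \<longleftrightarrow>
     (\<forall>X\<in>G_inf. closed_csubspace (Ofn X) \<and>
        (\<forall>u\<in>range L. \<forall>v\<in>Ofn X. cinner u v = 0) \<and>
        f X = {u + v | u v. u \<in> L ` X \<and> v \<in> Ofn X})"

end

theory Submission
  imports Defs
begin

text \<open>Orthogonality of a pair is symmetric and is preserved in both directions, so testing against
  orthogonal complements shows that \<open>f\<close> preserves inclusions. If \<open>p\<close> is orthogonal to \<open>X\<close>, then
  \<open>f (X \<oplus> \<complex>p)\<close> exceeds \<open>f X\<close> by a single line. This line is unchanged when \<open>X\<close> is enlarged inside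
  the complement of \<open>p\<close>, and any two admissible \<open>X\<close> are joined by a short chain of inclusions, so
  it depends on \<open>p\<close> only. Comparing \<open>X \<oplus> \<complex>p\<close> with \<open>X \<oplus> \<complex>q\<close> shows that the resulting map of lines
  preserves angles; Wigner's theorem lifts it to a linear or conjugate linear isometry \<open>L\<close>. Then
  \<open>L\<close> maps \<open>X\<close> into \<open>f X\<close> and the complement of \<open>X\<close> into the complement of \<open>f X\<close>, and
  \<open>O X\<close> is the part of \<open>f X\<close> orthogonal to the range of \<open>L\<close>.\<close>

section \<open>Complex Hilbert spaces\<close>

text \<open>The isometry changes with the pair and may swap its two members. So only relations
  between two subspaces can be exploited, and every application has to settle the swap: for
  inclusions it is ruled out; for the pairs used to compare lines it remains possible, but both
  orders lead to the same conclusion, since intersections, orthogonality and |<p, q>| are symmetric.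

  As \<open>f\<close> need not be onto, no argument may pass through preimages of subspaces. The
  line map is therefore treated by a form of Wigner's theorem without surjectivity, and
  \<open>f X\<close> may exceed the image of \<open>X\<close> by a remainder.

  Two subspaces orthogonal to \<open>p\<close> cannot be linked through their intersection, which
  may be zero; the link is a third subspace meeting both in infinite dimension. Its construction
  picks nonzero vectors orthogonal to finitely many earlier ones, so no orthonormal basis and no
  separability enter.\<close>

lemma scaleC_0_right [simp]: "scaleC a 0 = (0::'a::complex_hilbert)"
  using scaleC_add_right[of a "0::'a" 0] by simp

lemma scaleC_0_left [simp]: "scaleC 0 x = (0::'a::complex_hilbert)"
  using scaleC_of_real[of 0 x] by simp

lemma scaleC_1 [simp]: "scaleC 1 x = (x::'a::complex_hilbert)"
  using scaleC_of_real[of 1 x] by simp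

lemma scaleC_minus_left: "scaleC (- a) x = - scaleC a (x::'a::complex_hilbert)"
  using scaleC_add_left[of a "-a" x] by (simp add: eq_neg_iff_add_eq_0 add.commute)

lemma scaleC_minus_right: "scaleC a (- x) = - scaleC a (x::'a::complex_hilbert)"
  using scaleC_add_right[of a x "-x"] by (simp add: eq_neg_iff_add_eq_0 add.commute)

lemma scaleC_diff_right: "scaleC a (x - y) = scaleC a x - scaleC a (y::'a::complex_hilbert)"
  using scaleC_add_right[of a x "-y"] by (simp add: scaleC_minus_right)

lemma scaleC_diff_left: "scaleC (a - b) x = scaleC a x - scaleC b (x::'a::complex_hilbert)"
  using scaleC_add_left[of a "-b" x] by (simp add: scaleC_minus_left)

lemma scaleC_eq_0_iff [simp]: "scaleC a x = 0 \<longleftrightarrow> a = 0 \<or> x = (0::'a::complex_hilbert)"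
  using norm_scaleC[of a x] by (metis mult_eq_0_iff norm_eq_zero)

lemma scaleR_eq_scaleC: "r *\<^sub>R x = scaleC (of_real r) (x::'a::complex_hilbert)"
  by (simp add: scaleC_of_real)

lemma scaleC_complex: "scaleC a x = Re a *\<^sub>R x + Im a *\<^sub>R scaleC \<i> (x::'a::complex_hilbert)"
  by (subst complex_eq[of a]) (simp add: scaleC_add_left scaleR_eq_scaleC scaleC_scaleC mult.commute)

text \<open>The class assumes homogeneity of the norm only. By polarization, multiplication by
  \<open>\<i>\<close> also preserves the real inner product, and sesquilinearity of
  \<open>cinner\<close> rests on this.\<close>

lemma inner_scaleC_i: "inner (scaleC \<i> x) (scaleC \<i> y) = inner x (y::'a::complex_hilbert)"
proof -
  have "norm (scaleC \<i> x + scaleC \<i> y) = norm (x + y)"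
    by (simp add: norm_scaleC flip: scaleC_add_right)
  then have "(norm (scaleC \<i> x + scaleC \<i> y))\<^sup>2 = (norm (x + y))\<^sup>2" by simp
  then show ?thesis
    by (simp only: dot_norm) (simp add: norm_scaleC)
qed

lemma inner_scaleC_i_left: "inner (scaleC \<i> x) y = - inner x (scaleC \<i> (y::'a::complex_hilbert))"
  using inner_scaleC_i[of x "scaleC \<i> y"]
  by (simp add: scaleC_scaleC scaleC_minus_left)

lemma cinner_add_left: "cinner (x + y) z = cinner x z + cinner y z"
  by (simp add: cinner_def complex_eq_iff inner_add_left)

lemma cinner_add_right: "cinner x (y + z) = cinner x y + cinner x z"
  by (simp add: cinner_def complex_eq_iff inner_add_right scaleC_add_right)

lemma cinner_commute: "cinner y x = cnj (cinner x y)"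
  using inner_scaleC_i_left[of y x]
  by (simp add: cinner_def complex_eq_iff inner_commute)

lemma cinner_scaleC_left [simp]: "cinner (scaleC a x) y = a * cinner x y"
  by (simp add: scaleC_complex[of a x] cinner_add_left)
     (simp add: cinner_def complex_eq_iff inner_scaleC_i inner_scaleC_i_left scaleC_scaleC scaleC_minus_left)

lemma cinner_scaleC_right [simp]: "cinner x (scaleC a y) = cnj a * cinner x y"
  by (subst (1 2) cinner_commute) simp

lemma cinner_zero_left [simp]: "cinner 0 x = 0"
  by (simp add: cinner_def complex_eq_iff)

lemma cinner_zero_right [simp]: "cinner x 0 = 0"
  by (simp add: cinner_def complex_eq_iff)

lemma cinner_minus_left [simp]: "cinner (- x) y = - cinner x y"
  by (simp add: cinner_def complex_eq_iff)

lemma cinner_minus_right [simp]: "cinner x (- y) = - cinner x y"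
  by (subst (1 2) cinner_commute) simp

lemma cinner_diff_left: "cinner (x - y) z = cinner x z - cinner y z"
  using cinner_add_left[of x "-y" z] by simp

lemma cinner_diff_right: "cinner x (y - z) = cinner x y - cinner x z"
  using cinner_add_right[of x y "-z"] by simp

lemma cinner_self: "cinner x x = complex_of_real ((norm x)\<^sup>2)"
  using cinner_commute[of x x]
  by (simp add: complex_eq_iff cinner_def power2_norm_eq_inner)

lemma cinner_self_eq_0_iff [simp]: "cinner x x = 0 \<longleftrightarrow> x = 0"
  by (simp add: cinner_self)

lemma Re_cinner: "Re (cinner x y) = inner x y"
  by (simp add: cinner_def)

lemma cinner_eq_0_commute: "cinner x y = 0 \<longleftrightarrow> cinner y x = 0"
  by (subst cinner_commute) simp

lemma cinner_sum_left: "cinner (\<Sum>v\<in>T. g v) y = (\<Sum>v\<in>T. cinner (g v) y)"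
  by (induction T rule: infinite_finite_induct) (auto simp: cinner_add_left)

lemma bounded_linear_scaleC_left: "bounded_linear (\<lambda>a. scaleC a (x::'a::complex_hilbert))"
  by (rule bounded_linear_intro[where K = "norm x"])
     (auto simp: scaleC_add_left norm_scaleC scaleR_eq_scaleC scaleC_scaleC scaleR_conv_of_real)

lemma continuous_on_cinner_left: "continuous_on UNIV (\<lambda>x. cinner x y)"
  unfolding cinner_def Complex_eq by (intro continuous_intros)

lemma cinner_line_residue:
  "cinner (v - scaleC (cinner v u / cinner u u) u) u = 0"
  by (cases "u = 0") (auto simp: cinner_diff_left)

lemma norm_add_orth:
  assumes "cinner x y = 0" shows "(norm (x + y))\<^sup>2 = (norm x)\<^sup>2 + (norm y)\<^sup>2"
  using Re_cinner[of x y] assms by (intro norm_add_Pythagorean) (simp add: orthogonal_def)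

text \<open>Equality case of Cauchy-Schwarz: the projection of \<open>v\<close> to the line of
  \<open>u\<close> already has the norm of \<open>v\<close>, so Pythagoras leaves no room for a
  residue.\<close>

lemma cinner_collinear:
  assumes "cmod (cinner u v) = norm u * norm v" "u \<noteq> 0"
  shows "\<exists>c. v = scaleC c u"
proof -
  define c where "c = cinner v u / cinner u u"
  let ?w = "v - scaleC c u"
  have wu: "cinner ?w u = 0" unfolding c_def by (rule cinner_line_residue)
  have "cmod c = norm v / norm u"
    using assms cinner_commute[of u v] by (simp add: c_def cinner_self norm_divide norm_power power2_eq_square norm_mult)
  then have n: "norm (scaleC c u) = norm v" using assms(2) by (simp add: norm_scaleC)
  have "(norm v)\<^sup>2 = (norm (?w + scaleC c u))\<^sup>2" by simp
  also have "\<dots> = (norm ?w)\<^sup>2 + (norm (scaleC c u))\<^sup>2"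
    using wu by (intro norm_add_orth) simp
  finally have "norm ?w = 0" using n by simp
  then show ?thesis by auto
qed

section \<open>Subspaces, orthogonal complements and infinite dimension\<close>

lemma csubspaceD:
  assumes "csubspace S"
  shows csubspace_0: "0 \<in> S"
    and csubspace_add: "x \<in> S \<Longrightarrow> y \<in> S \<Longrightarrow> x + y \<in> S"
    and csubspace_scaleC: "x \<in> S \<Longrightarrow> scaleC a x \<in> S"
  using assms by (auto simp: csubspace_def)

lemma csubspace_minus: "csubspace S \<Longrightarrow> x \<in> S \<Longrightarrow> - x \<in> S"
  using csubspace_scaleC[of S x "-1"] by (simp add: scaleC_minus_left)

lemma csubspace_diff: "csubspace S \<Longrightarrow> x \<in> S \<Longrightarrow> y \<in> S \<Longrightarrow> x - y \<in> S"
  using csubspace_add[of S x "-y"] csubspace_minus[of S y] by simp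

lemma csubspace_scaleC_cancel: "csubspace S \<Longrightarrow> scaleC a x \<in> S \<Longrightarrow> a \<noteq> 0 \<Longrightarrow> x \<in> S"
  using csubspace_scaleC[of S "scaleC a x" "inverse a"] by (simp add: scaleC_scaleC)

lemma closed_csubspace_UNIV: "closed_csubspace UNIV"
  by (simp add: closed_csubspace_def csubspace_def)

lemma closed_csubspace_Int: "closed_csubspace S \<Longrightarrow> closed_csubspace T \<Longrightarrow> closed_csubspace (S \<inter> T)"
  by (auto simp: closed_csubspace_def csubspace_def)

lemma closed_csubspace_csubspace: "closed_csubspace S \<Longrightarrow> csubspace S"
  by (simp add: closed_csubspace_def)

lemma orth_complD: "y \<in> orth_compl S \<Longrightarrow> x \<in> S \<Longrightarrow> cinner x y = 0"
  and orth_complD': "y \<in> orth_compl S \<Longrightarrow> x \<in> S \<Longrightarrow> cinner y x = 0"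
  by (auto simp: orth_compl_def cinner_eq_0_commute[of y x])

lemma orth_complI: "(\<And>x. x \<in> S \<Longrightarrow> cinner y x = 0) \<Longrightarrow> y \<in> orth_compl S"
  using cinner_eq_0_commute by (auto simp: orth_compl_def)

lemma orth_compl_antimono: "S \<subseteq> T \<Longrightarrow> orth_compl T \<subseteq> orth_compl S"
  by (auto simp: orth_compl_def)

lemma orth_compl_orth_compl_superset: "S \<subseteq> orth_compl (orth_compl S)"
  by (auto intro!: orth_complI dest: orth_complD)

lemma closed_csubspace_orth_compl: "closed_csubspace (orth_compl S)"
proof -
  have "orth_compl S = (\<Inter>x\<in>S. {y. cinner y x = 0})"
    using cinner_eq_0_commute by (auto simp: orth_compl_def)
  moreover have "closed {y. cinner y x = 0}" for x :: 'a
    by (intro closed_Collect_eq continuous_on_cinner_left continuous_on_const)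
  ultimately show ?thesis
    unfolding closed_csubspace_def
    by (auto simp: csubspace_def cinner_add_left)
qed

lemmas csubspace_orth_compl = closed_csubspace_csubspace[OF closed_csubspace_orth_compl]

text \<open>A basis-free form of infinite dimension: in a finite-dimensional \<open>S\<close>, a
  basis as \<open>F\<close> would leave only 0. It is monotone in \<open>S\<close> and hands out
  exactly the next vector needed when an orthogonal sequence is chosen recursively.\<close>

definition meets_fin_orth :: "'a::complex_hilbert set \<Rightarrow> bool" where
  "meets_fin_orth S \<longleftrightarrow> (\<forall>F. finite F \<longrightarrow> (\<exists>w\<in>S. w \<noteq> 0 \<and> (\<forall>v\<in>F. cinner w v = 0)))"

text \<open>If some \<open>b\<close> in the independent set \<open>A\<close> is not orthogonal to
  \<open>q\<close>, subtracting multiples of \<open>b\<close> moves the other elements into the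
  complement of \<open>q\<close>. A relation among the corrected vectors is one among elements of
  \<open>A\<close>, so independence survives.\<close>

lemma infinite_cdim_orth_vector:
  assumes "csubspace S" "infinite_cdim S"
  shows "infinite_cdim (S \<inter> orth_compl {q})"
proof -
  obtain A where A: "A \<subseteq> S" "infinite A" "\<not> cdependent A"
    using assms(2) by (auto simp: infinite_cdim_def)
  show ?thesis
  proof (cases "\<exists>a\<in>A. cinner a q \<noteq> 0")
    case False
    then have "A \<subseteq> S \<inter> orth_compl {q}" using A(1) by (auto intro!: orth_complI)
    then show ?thesis using A unfolding infinite_cdim_def by blast
  next
    case True
    then obtain b where b: "b \<in> A" "cinner b q \<noteq> 0" by blast
    define k where "k a = cinner a q / cinner b q" for a
    define h where "h a = a - scaleC (k a) b" for a
    have indep: "u v = 0" if "finite T" "T \<subseteq> A" "(\<Sum>v\<in>T. scaleC (u v) v) = 0" "v \<in> T" for T u v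
      using A(3) that unfolding cdependent_def by blast
    have inj: "inj_on h (A - {b})"
    proof
      fix x y assume xy: "x \<in> A - {b}" "y \<in> A - {b}" "h x = h y"
      show "x = y"
      proof (rule ccontr)
        assume "x \<noteq> y"
        \<comment> \<open>With these coefficients the sum is \<open>h x - h y\<close>, so equal
          images would give a nontrivial relation in \<open>A\<close>.\<close>
        define u where "u v = (if v = x then 1 else if v = y then -1 else k y - k x)" for v
        have "(\<Sum>v\<in>{x, y, b}. scaleC (u v) v) = x - y + scaleC (k y - k x) b"
          using xy \<open>x \<noteq> y\<close> by (auto simp: u_def scaleC_minus_left)
        also have "\<dots> = h x - h y" by (simp add: h_def scaleC_diff_left)
        finally show False
          using indep[of "{x, y, b}" u x] xy b by (simp add: u_def)
      qed
    qed
    have "\<not> cdependent (h ` (A - {b}))"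
    proof
      assume "cdependent (h ` (A - {b}))"
      then obtain T' u where T': "finite T'" "T' \<subseteq> h ` (A - {b})"
        "(\<Sum>v\<in>T'. scaleC (u v) v) = 0" "\<exists>v\<in>T'. u v \<noteq> 0"
        unfolding cdependent_def by blast
      obtain T where T: "T \<subseteq> A - {b}" "finite T" "T' = h ` T"
        using finite_subset_image[OF T'(1,2)] by blast
      have "(\<Sum>v\<in>T'. scaleC (u v) v) = (\<Sum>a\<in>T. scaleC (u (h a)) (h a))"
        unfolding T(3) by (subst sum.reindex) (use inj T in \<open>auto intro: inj_on_subset\<close>)
      also have "\<dots> = (\<Sum>a\<in>T. scaleC (u (h a)) a) - (\<Sum>a\<in>T. scaleC (u (h a) * k a) b)"
        by (simp add: h_def scaleC_diff_right scaleC_scaleC sum_subtractf)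
      also have "(\<Sum>a\<in>T. scaleC (u (h a) * k a) b) = scaleC (\<Sum>a\<in>T. u (h a) * k a) b"
        by (simp add: linear_sum[OF bounded_linear.linear[OF bounded_linear_scaleC_left]])
      finally have eq: "(\<Sum>a\<in>T. scaleC (u (h a)) a) - scaleC (\<Sum>a\<in>T. u (h a) * k a) b = 0"
        using T'(3) by simp
      \<comment> \<open>The coefficient of \<open>b\<close> collects all corrections, while those on
        \<open>T\<close> are unchanged and must vanish by independence.\<close>
      define w where "w v = (if v = b then - (\<Sum>a\<in>T. u (h a) * k a) else u (h v))" for v
      have "b \<notin> T" using T by auto
      then have "(\<Sum>v\<in>insert b T. scaleC (w v) v) =
          scaleC (w b) b + (\<Sum>v\<in>T. scaleC (u (h v)) v)"
        using T(2) by (auto simp: w_def intro!: sum.cong)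
      also have "\<dots> = 0" using eq by (simp add: w_def scaleC_minus_left)
      finally have "w v = 0" if "v \<in> T" for v
        using indep[of "insert b T" w v] T b that by auto
      then have "u (h v) = 0" if "v \<in> T" for v
        using that \<open>b \<notin> T\<close> by (metis w_def)
      then show False using T'(4) T(3) by auto
    qed
    moreover have "infinite (h ` (A - {b}))"
      using inj A(2) by (simp add: finite_image_iff)
    moreover have "h ` (A - {b}) \<subseteq> S \<inter> orth_compl {q}"
      using A(1) b assms(1)
      by (auto simp: h_def k_def cinner_diff_left intro!: orth_complI csubspace_diff csubspace_scaleC)
    ultimately show ?thesis unfolding infinite_cdim_def by blast
  qed
qed

text \<open>Orthogonality is demanded only against earlier members, because this is what a recursive
  choice delivers.\<close>

lemma infinite_cdim_orthogonal_sequence: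
  fixes x :: "nat \<Rightarrow> 'a::complex_hilbert"
  assumes "\<And>n. x n \<in> S" "\<And>n. x n \<noteq> 0" "\<And>m n. m < n \<Longrightarrow> cinner (x n) (x m) = 0"
  shows "infinite_cdim S"
proof -
  have orth: "cinner (x n) (x m) = 0" if "m \<noteq> n" for m n
    using assms(3)[of m n] assms(3)[of n m] that cinner_eq_0_commute[of "x m" "x n"]
    by (cases "m < n") auto
  have "inj x"
  proof
    fix m n assume "x m = x n"
    then show "m = n" using orth[of m n] assms(2)[of n] by auto
  qed
  then have "infinite (range x)" by (simp add: finite_image_iff)
  moreover have "\<not> cdependent (range x)"
  proof
    assume "cdependent (range x)"
    then obtain T u v where T: "finite T" "T \<subseteq> range x" "(\<Sum>v\<in>T. scaleC (u v) v) = 0" "v \<in> T" "u v \<noteq> 0"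
      unfolding cdependent_def by blast
    have "0 = cinner (\<Sum>v\<in>T. scaleC (u v) v) v" using T by simp
    also have "\<dots> = (\<Sum>w\<in>T. u w * cinner w v)" by (simp add: cinner_sum_left)
    also have "\<dots> = (\<Sum>w\<in>T. if w = v then u v * cinner v v else 0)"
    proof (intro sum.cong refl)
      fix w assume "w \<in> T"
      then obtain m n where "w = x m" "v = x n" using T(2,4) by blast
      then show "u w * cinner w v = (if w = v then u v * cinner v v else 0)"
        using orth[of n m] by (cases "m = n") auto
    qed
    also have "\<dots> = u v * cinner v v" using T by simp
    finally have "v = 0" using T(5) by simp
    then show False using T(2,4) assms(2) by auto
  qed
  ultimately show ?thesis using assms(1) unfolding infinite_cdim_def by blast
qed

lemma csubspace_Int: "csubspace S \<Longrightarrow> csubspace T \<Longrightarrow> csubspace (S \<inter> T)"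
  by (auto simp: csubspace_def)

lemma infinite_cdim_orth_finite:
  assumes "finite F" "csubspace S" "infinite_cdim S"
  shows "infinite_cdim (S \<inter> orth_compl F)"
  using assms
proof (induction F)
  case empty
  then show ?case by (simp add: orth_compl_def)
next
  case (insert q F)
  have "S \<inter> orth_compl (insert q F) = S \<inter> orth_compl F \<inter> orth_compl {q}"
    by (auto simp: orth_compl_def)
  moreover have "infinite_cdim (S \<inter> orth_compl F \<inter> orth_compl {q})"
    using insert by (intro infinite_cdim_orth_vector csubspace_Int csubspace_orth_compl)
  ultimately show ?case by (simp only:)
qed

lemma infinite_cdim_nonzero: "infinite_cdim S \<Longrightarrow> \<exists>w\<in>S. w \<noteq> 0"
proof (rule ccontr)
  assume "infinite_cdim S" "\<not> (\<exists>w\<in>S. w \<noteq> 0)"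
  then have "S \<subseteq> {0}" by blast
  with \<open>infinite_cdim S\<close> show False
    unfolding infinite_cdim_def by (meson finite.emptyI finite.insertI finite_subset)
qed

lemma infinite_cdim_meets_fin_orth:
  assumes "csubspace S" "infinite_cdim S"
  shows "meets_fin_orth S"
  unfolding meets_fin_orth_def
proof (intro allI impI)
  fix F :: "'a set"
  assume "finite F"
  then obtain w where "w \<in> S" "w \<in> orth_compl F" "w \<noteq> 0"
    using infinite_cdim_nonzero[OF infinite_cdim_orth_finite[OF _ assms]] by blast
  then show "\<exists>w\<in>S. w \<noteq> 0 \<and> (\<forall>v\<in>F. cinner w v = 0)"
    using orth_complD' by blast
qed

lemma meets_fin_orth_infinite_cdim:
  assumes "meets_fin_orth S" shows "infinite_cdim S"
proof -
  \<comment> \<open>A state is the set \<open>F\<close> of earlier vectors with the new one;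
    carrying the history lets dependent choice look back one step only.\<close>
  define P where "P = (\<lambda>(F, x). finite F \<and> x \<in> S \<and> x \<noteq> 0 \<and> (\<forall>v\<in>F. cinner x v = 0))"
  have ex: "\<exists>x. P (F, x)" if "finite F" for F
    using assms that unfolding meets_fin_orth_def P_def by auto
  have "\<exists>s. \<forall>n. P (s n) \<and> fst (s (Suc n)) = insert (snd (s n)) (fst (s n))"
  proof (rule dependent_nat_choice)
    show "\<exists>s. P s" using ex[of "{}"] by blast
    show "\<exists>t. P t \<and> fst t = insert (snd s) (fst s)" if "P s" for s
    proof -
      have "finite (insert (snd s) (fst s))" using that by (auto simp: P_def)
      then obtain x where "P (insert (snd s) (fst s), x)" using ex by blast
      then show ?thesis by (intro exI[of _ "(insert (snd s) (fst s), x)"]) simp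
    qed
  qed
  then obtain s where s: "\<And>n. P (s n)" "\<And>n. fst (s (Suc n)) = insert (snd (s n)) (fst (s n))"
    by blast
  have hist: "snd (s m) \<in> fst (s n)" if "m < n" for m n
    using that by (induction n) (auto simp: s(2) less_Suc_eq)
  have "snd (s n) \<in> S" "snd (s n) \<noteq> 0" "\<forall>v\<in>fst (s n). cinner (snd (s n)) v = 0" for n
    using s(1)[of n] by (simp_all add: P_def case_prod_beta)
  then show ?thesis
    using hist by (intro infinite_cdim_orthogonal_sequence[of "\<lambda>n. snd (s n)"]) blast+
qed

lemma infinite_cdim_iff: "csubspace S \<Longrightarrow> infinite_cdim S \<longleftrightarrow> meets_fin_orth S"
  using infinite_cdim_meets_fin_orth meets_fin_orth_infinite_cdim by blast

section \<open>Orthogonal projection to closed subspaces\<close>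

lemma projection_exists:
  assumes "closed_csubspace S"
  obtains s where "s \<in> S" "x - s \<in> orth_compl S"
proof -
  have S: "csubspace S" "closed S" using assms by (auto simp: closed_csubspace_def)
  define D where "D = (\<lambda>s. (norm (x - s))\<^sup>2) ` S"
  define d where "d = Inf D"
  have D: "D \<noteq> {}" "bdd_below D"
    using csubspace_0[OF S(1)] by (auto simp: D_def intro!: bdd_belowI[of _ 0])
  have d_le: "d \<le> (norm (x - s))\<^sup>2" if "s \<in> S" for s
    unfolding d_def by (rule cInf_lower) (use that D in \<open>auto simp: D_def\<close>)
  have "\<exists>s\<in>S. (norm (x - s))\<^sup>2 < d + 1 / Suc n" for n
    using cInf_less_iff[OF D, of "d + 1 / Suc n"] by (auto simp: D_def d_def)
  then obtain s where s: "\<And>n. s n \<in> S" "\<And>n. (norm (x - s n))\<^sup>2 < d + 1 / Suc n"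
    by metis
  have half: "scaleC (1/2) (a + b) \<in> S" if "a \<in> S" "b \<in> S" for a b
    using that S(1) by (intro csubspace_scaleC csubspace_add)
  \<comment> \<open>Parallelogram law: the midpoint of two almost minimal points lies in
    \<open>S\<close> and is no closer to \<open>x\<close> than the infimum allows, which forces the
    points together.\<close>
  have close: "(norm (s m - s n))\<^sup>2 < 2 / Suc m + 2 / Suc n" for m n
  proof -
    let ?h = "scaleC (1/2) (s m + s n)"
    have h2: "?h = (1/2) *\<^sub>R (s m + s n)" by (simp add: scaleR_eq_scaleC)
    have "(norm (s m - s n))\<^sup>2 + 4 * (norm (x - ?h))\<^sup>2
        = 2 * (norm (x - s m))\<^sup>2 + 2 * (norm (x - s n))\<^sup>2"
      unfolding h2 power2_norm_eq_inner
      by (simp add: inner_diff_left inner_diff_right inner_add_left inner_add_right inner_commute algebra_simps)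
    with d_le[OF half[OF s(1)[of m] s(1)[of n]]] s(2)[of m] s(2)[of n] show ?thesis by simp
  qed
  have "Cauchy s"
  proof (rule metric_CauchyI)
    fix e :: real assume "e > 0"
    then obtain N where N: "inverse (real (Suc N)) < e\<^sup>2 / 4"
      using reals_Archimedean[of "e\<^sup>2 / 4"] by auto
    show "\<exists>M. \<forall>m\<ge>M. \<forall>n\<ge>M. dist (s m) (s n) < e"
    proof (intro exI allI impI)
      fix m n assume "N \<le> m" "N \<le> n"
      then have "1 / real (Suc m) \<le> inverse (Suc N)" "1 / real (Suc n) \<le> inverse (Suc N)"
        by (simp_all add: inverse_eq_divide frac_le)
      then have "(norm (s m - s n))\<^sup>2 < e\<^sup>2"
        using close[of m n] N by simp
      then show "dist (s m) (s n) < e"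
        using \<open>e > 0\<close> by (simp add: dist_norm power2_less_imp_less)
    qed
  qed
  then obtain l where l: "s \<longlonglongrightarrow> l" using Cauchy_convergent convergentD by blast
  have lS: "l \<in> S" using closed_sequentially[OF S(2) s(1) l] .
  have "(\<lambda>n. (norm (x - s n))\<^sup>2) \<longlonglongrightarrow> (norm (x - l))\<^sup>2" by (intro tendsto_intros l)
  moreover have "(\<lambda>n. d + 1 / Suc n) \<longlonglongrightarrow> d"
    using tendsto_add[OF tendsto_const LIMSEQ_inverse_real_of_nat, of d] by (simp add: inverse_eq_divide)
  ultimately have min: "(norm (x - l))\<^sup>2 \<le> d"
    by (rule LIMSEQ_le) (use s(2) less_imp_le in blast)
  have "cinner (x - l) y = 0" if "y \<in> S" for y
  proof -
    \<comment> \<open>Moving \<open>l\<close> by the projection of \<open>x - l\<close> to the line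
      of \<open>y\<close> cannot reduce the distance, but by Pythagoras it does unless that
      projection vanishes.\<close>
    define c where "c = cinner (x - l) y / cinner y y"
    let ?w = "x - l - scaleC c y"
    have wy: "cinner ?w y = 0" unfolding c_def by (rule cinner_line_residue)
    have "(norm (x - l))\<^sup>2 = (norm (?w + scaleC c y))\<^sup>2" by simp
    also have "\<dots> = (norm ?w)\<^sup>2 + (norm (scaleC c y))\<^sup>2"
      using wy by (intro norm_add_orth) simp
    finally have "(norm ?w)\<^sup>2 + (norm (scaleC c y))\<^sup>2 \<le> d" using min by simp
    moreover have "d \<le> (norm ?w)\<^sup>2"
      using d_le[OF csubspace_add[OF S(1) lS csubspace_scaleC[OF S(1) that]], of c]
      by (simp add: diff_diff_eq)
    ultimately have "(norm (scaleC c y))\<^sup>2 \<le> 0" by linarith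
    then have "scaleC c y = 0" by simp
    then show ?thesis using wy by auto
  qed
  then have "x - l \<in> orth_compl S" by (rule orth_complI)
  then show ?thesis using lS that by blast
qed

lemma orth_compl_orth_compl:
  assumes "closed_csubspace S" shows "orth_compl (orth_compl S) = S"
proof
  show "S \<subseteq> orth_compl (orth_compl S)" by (rule orth_compl_orth_compl_superset)
  show "orth_compl (orth_compl S) \<subseteq> S"
  proof
    fix x assume x: "x \<in> orth_compl (orth_compl S)"
    obtain s where s: "s \<in> S" "x - s \<in> orth_compl S" by (rule projection_exists[OF assms])
    have "x - s \<in> orth_compl (orth_compl S)"
      using x subsetD[OF orth_compl_orth_compl_superset s(1)]
      by (rule csubspace_diff[OF csubspace_orth_compl])
    then have "cinner (x - s) (x - s) = 0" using s(2) by (rule orth_complD)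
    then show "x \<in> S" using s by simp
  qed
qed

section \<open>Isometries and subspaces of infinite dimension and codimension\<close>

text \<open>Both kinds of map share additivity and preservation of norms, of orthogonality and of
  the modulus of \<open>cinner\<close>; proofs resting on these treat them together.\<close>

definition semi_isometry :: "('a::complex_hilbert \<Rightarrow> 'a) \<Rightarrow> bool" where
  "semi_isometry L \<longleftrightarrow> linear_isometry L \<or> conj_linear_isometry L"

lemma linear_isometry_semi: "linear_isometry L \<Longrightarrow> semi_isometry L"
  by (simp add: semi_isometry_def)

lemma semi_isometry_add: "semi_isometry L \<Longrightarrow> L (x + y) = L x + L y"
  by (auto simp: semi_isometry_def linear_isometry_def conj_linear_isometry_def
      clinear_map_def cconj_linear_map_def)

lemma semi_isometry_norm: "semi_isometry L \<Longrightarrow> norm (L x) = norm x"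
  by (auto simp: semi_isometry_def linear_isometry_def conj_linear_isometry_def)

lemma linear_isometry_scaleC: "linear_isometry L \<Longrightarrow> L (scaleC a x) = scaleC a (L x)"
  by (auto simp: linear_isometry_def clinear_map_def)

lemma conj_linear_isometry_scaleC: "conj_linear_isometry L \<Longrightarrow> L (scaleC a x) = scaleC (cnj a) (L x)"
  by (auto simp: conj_linear_isometry_def cconj_linear_map_def)

lemma semi_isometry_scaleC:
  assumes "semi_isometry L"
  shows "\<exists>b. cmod b = cmod a \<and> (\<forall>x. L (scaleC a x) = scaleC b (L x))"
    and "\<exists>b. \<forall>x. scaleC a (L x) = L (scaleC b x)"
proof -
  consider "linear_isometry L" | "conj_linear_isometry L" using assms by (auto simp: semi_isometry_def)
  then show "\<exists>b. cmod b = cmod a \<and> (\<forall>x. L (scaleC a x) = scaleC b (L x))"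
  proof cases
    case 1 then show ?thesis by (intro exI[of _ a]) (simp add: linear_isometry_scaleC)
  next
    case 2 then show ?thesis by (intro exI[of _ "cnj a"]) (simp add: conj_linear_isometry_scaleC)
  qed
  consider "linear_isometry L" | "conj_linear_isometry L" using assms by (auto simp: semi_isometry_def)
  then show "\<exists>b. \<forall>x. scaleC a (L x) = L (scaleC b x)"
  proof cases
    case 1 then show ?thesis by (intro exI[of _ a]) (simp add: linear_isometry_scaleC)
  next
    case 2 then show ?thesis by (intro exI[of _ "cnj a"]) (simp add: conj_linear_isometry_scaleC)
  qed
qed

lemma semi_isometry_0: "semi_isometry L \<Longrightarrow> L 0 = 0"
  using semi_isometry_norm[of L 0] by simp

lemma semi_isometry_diff: "semi_isometry L \<Longrightarrow> L (x - y) = L x - L y"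
  using semi_isometry_add[of L "x - y" y] by (simp add: algebra_simps)

lemma semi_isometry_inner: "semi_isometry L \<Longrightarrow> inner (L x) (L y) = inner x y"
  by (simp add: dot_norm semi_isometry_norm flip: semi_isometry_add)

lemma linear_isometry_cinner: "linear_isometry L \<Longrightarrow> cinner (L x) (L y) = cinner x y"
  using semi_isometry_inner[OF linear_isometry_semi, of L x "scaleC \<i> y"]
  by (simp add: cinner_def linear_isometry_scaleC semi_isometry_inner linear_isometry_semi)

lemma conj_linear_isometry_cinner: "conj_linear_isometry L \<Longrightarrow> cinner (L x) (L y) = cnj (cinner x y)"
  using semi_isometry_inner[of L x "scaleC \<i> y"]
  by (simp add: cinner_def complex_eq_iff conj_linear_isometry_scaleC scaleC_minus_left
      semi_isometry_inner semi_isometry_def)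

lemma semi_isometry_orth: "semi_isometry L \<Longrightarrow> cinner (L x) (L y) = 0 \<longleftrightarrow> cinner x y = 0"
  by (auto simp: semi_isometry_def linear_isometry_cinner conj_linear_isometry_cinner)

lemma semi_isometry_cmod_cinner: "semi_isometry L \<Longrightarrow> cmod (cinner (L x) (L y)) = cmod (cinner x y)"
  by (auto simp: semi_isometry_def linear_isometry_cinner conj_linear_isometry_cinner)

lemma semi_isometry_inj:
  assumes "semi_isometry L" shows "inj L"
proof
  fix x y assume "L x = L y"
  then have "norm (L (x - y)) = 0" by (simp add: semi_isometry_diff[OF assms])
  then show "x = y" by (simp add: semi_isometry_norm[OF assms])
qed

text \<open>Closedness comes from completeness: a convergent sequence of images is Cauchy, hence so
  is the sequence of its preimages.\<close>

lemma closed_csubspace_image: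
  assumes L: "semi_isometry L" and X: "closed_csubspace X"
  shows "closed_csubspace (L ` X)"
proof -
  have X': "csubspace X" "closed X" using X by (auto simp: closed_csubspace_def)
  have "csubspace (L ` X)"
    unfolding csubspace_def
  proof (intro conjI ballI allI)
    show "0 \<in> L ` X" using imageI[OF csubspace_0[OF X'(1)], of L] by (simp add: semi_isometry_0[OF L])
    show "u + v \<in> L ` X" if "u \<in> L ` X" "v \<in> L ` X" for u v
    proof -
      from that obtain x y where "x \<in> X" "y \<in> X" "u = L x" "v = L y" by blast
      then show ?thesis
        using imageI[OF csubspace_add[OF X'(1)], of x y L] by (simp add: semi_isometry_add[OF L])
    qed
    show "scaleC a u \<in> L ` X" if "u \<in> L ` X" for a u
    proof -
      from that obtain x where x: "x \<in> X" "u = L x" by blast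
      obtain b where "\<forall>x. scaleC a (L x) = L (scaleC b x)" using semi_isometry_scaleC(2)[OF L] ..
      then show ?thesis using imageI[OF csubspace_scaleC[OF X'(1) x(1)], of L b] x(2) by simp
    qed
  qed
  moreover have "closed (L ` X)"
    unfolding closed_sequential_limits
  proof (intro allI impI, elim conjE)
    fix y l assume y: "\<forall>n. y n \<in> L ` X" "y \<longlonglongrightarrow> l"
    have "\<exists>x. x \<in> X \<and> y n = L x" for n using y(1) by blast
    then obtain x where x: "\<And>n. x n \<in> X" "\<And>n. y n = L (x n)" by metis
    have "Cauchy y" using y(2) by (simp add: LIMSEQ_imp_Cauchy)
    then have "Cauchy x"
      by (simp add: Cauchy_def x(2) dist_norm semi_isometry_norm[OF L] flip: semi_isometry_diff[OF L])
    then obtain k where k: "x \<longlonglongrightarrow> k" using Cauchy_convergent convergentD by blast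
    have "dist (y n) (L k) = dist (x n) k" for n
      by (simp add: x(2) dist_norm semi_isometry_norm[OF L] flip: semi_isometry_diff[OF L])
    then have "y \<longlonglongrightarrow> L k" using k by (simp add: tendsto_dist_iff[where f = y] tendsto_dist_iff[where f = x])
    then have "l = L k" using y(2) LIMSEQ_unique by blast
    then show "l \<in> L ` X" using closed_sequentially[OF X'(2) x(1) k] by blast
  qed
  ultimately show ?thesis by (simp add: closed_csubspace_def)
qed

section \<open>Adding a line to a subspace\<close>

definition adjoin :: "'a::complex_hilbert set \<Rightarrow> 'a \<Rightarrow> 'a set" where
  "adjoin X p = {y. \<exists>c. y - scaleC c p \<in> X}"

lemma adjoin_superset: "X \<subseteq> adjoin X p"
  by (auto simp: adjoin_def intro!: exI[of _ 0])

lemma scaleC_in_adjoin: "0 \<in> X \<Longrightarrow> scaleC c p \<in> adjoin X p"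
  by (auto simp: adjoin_def intro!: exI[of _ c])

lemma mem_adjoin: "0 \<in> X \<Longrightarrow> p \<in> adjoin X p"
  using scaleC_in_adjoin[of X 1 p] by simp

lemma adjoinE:
  assumes "y \<in> adjoin X p" obtains x c where "x \<in> X" "y = x + scaleC c p"
proof -
  obtain c where "y - scaleC c p \<in> X" using assms by (auto simp: adjoin_def)
  then show thesis by (intro that[of "y - scaleC c p" c]) auto
qed

lemma adjoin_subset: "csubspace Y \<Longrightarrow> X \<subseteq> Y \<Longrightarrow> p \<in> Y \<Longrightarrow> adjoin X p \<subseteq> Y"
  by (auto elim!: adjoinE intro: csubspace_add csubspace_scaleC)

lemma adjoin_mono: "X \<subseteq> Y \<Longrightarrow> adjoin X p \<subseteq> adjoin Y p"
  by (auto simp: adjoin_def)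

lemma csubspace_adjoin:
  assumes "csubspace X" shows "csubspace (adjoin X p)"
  unfolding csubspace_def
proof (intro conjI ballI allI)
  show "0 \<in> adjoin X p" using subsetD[OF adjoin_superset csubspace_0[OF assms]] .
  fix u v assume u: "u \<in> adjoin X p"
  then obtain c where c: "u - scaleC c p \<in> X" by (auto simp: adjoin_def)
  show "scaleC a u \<in> adjoin X p" for a
    using csubspace_scaleC[OF assms c, of a]
    by (auto simp: adjoin_def scaleC_diff_right scaleC_scaleC)
  assume "v \<in> adjoin X p"
  then obtain d where d: "v - scaleC d p \<in> X" by (auto simp: adjoin_def)
  show "u + v \<in> adjoin X p"
    using csubspace_add[OF assms c d] by (auto simp: adjoin_def scaleC_add_left algebra_simps intro!: exI[of _ "c + d"])
qed

text \<open>For \<open>p\<close> orthogonal to \<open>X\<close> the sum is the preimage of the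
  closed set \<open>X\<close> under the continuous removal of the
  \<open>p\<close>-component.\<close>

lemma closed_csubspace_adjoin:
  assumes X: "closed_csubspace X" and p: "p \<in> orth_compl X"
  shows "closed_csubspace (adjoin X p)"
proof -
  let ?f = "\<lambda>y. y - scaleC (cinner y p / cinner p p) p"
  have X': "csubspace X" "closed X" using X by (auto simp: closed_csubspace_def)
  have "adjoin X p = ?f -` X"
  proof (cases "p = 0")
    case True
    then show ?thesis by (auto simp: adjoin_def)
  next
    case False
    show ?thesis
    proof (intro set_eqI iffI)
      fix y assume "y \<in> adjoin X p"
      then obtain x c where x: "x \<in> X" "y = x + scaleC c p" by (rule adjoinE)
      then have "?f y = x" using orth_complD[OF p x(1)] False by (simp add: cinner_add_left)
      then show "y \<in> ?f -` X" using x by simp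
    qed (auto simp: adjoin_def)
  qed
  moreover have "continuous_on UNIV ?f"
  proof -
    have "continuous_on UNIV (\<lambda>y. scaleC (cinner y p / cinner p p) p)"
      by (rule continuous_on_compose2[OF linear_continuous_on[OF bounded_linear_scaleC_left, of UNIV]])
         (auto simp: divide_inverse intro!: continuous_intros continuous_on_cinner_left)
    then show ?thesis by (intro continuous_intros)
  qed
  ultimately have "closed (adjoin X p)"
    using X'(2) by (metis closed_vimage)
  then show ?thesis using csubspace_adjoin[OF X'(1)] by (simp add: closed_csubspace_def)
qed

lemma orth_compl_adjoin:
  assumes "csubspace X" shows "orth_compl (adjoin X p) = orth_compl X \<inter> orth_compl {p}"
    (is "?l = ?r")
proof
  show "?l \<subseteq> ?r"
    using orth_compl_antimono[OF adjoin_superset[of X p]] mem_adjoin[OF csubspace_0[OF assms], of p]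
    by (auto simp: orth_compl_def)
  show "?r \<subseteq> ?l"
    by (auto simp: orth_compl_def cinner_add_left elim!: adjoinE)
qed

section \<open>Closure properties of \<open>G_inf\<close>\<close>

lemma G_infD:
  assumes "X \<in> G_inf"
  shows G_inf_closed: "closed_csubspace X"
    and G_inf_csubspace: "csubspace X"
    and G_inf_meets: "meets_fin_orth X"
    and G_inf_orth_meets: "meets_fin_orth (orth_compl X)"
  using assms by (auto simp: G_inf_def closed_csubspace_def infinite_cdim_iff csubspace_orth_compl)

lemma G_infI: "closed_csubspace X \<Longrightarrow> meets_fin_orth X \<Longrightarrow> meets_fin_orth (orth_compl X) \<Longrightarrow> X \<in> G_inf"
  by (auto simp: G_inf_def closed_csubspace_def infinite_cdim_iff csubspace_orth_compl)

lemma meets_fin_orth_mono: "meets_fin_orth X \<Longrightarrow> X \<subseteq> Y \<Longrightarrow> meets_fin_orth Y"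
  unfolding meets_fin_orth_def by (meson subsetD)

lemma meets_fin_orth_Int_orth_compl:
  assumes "meets_fin_orth X" "finite F" shows "meets_fin_orth (X \<inter> orth_compl F)"
  unfolding meets_fin_orth_def
proof (intro allI impI)
  fix G :: "'a set" assume "finite G"
  then obtain w where w: "w \<in> X" "w \<noteq> 0" "\<forall>v\<in>F \<union> G. cinner w v = 0"
    using assms unfolding meets_fin_orth_def by (metis finite_Un)
  then have "w \<in> orth_compl F" by (auto intro: orth_complI)
  with w show "\<exists>w\<in>X \<inter> orth_compl F. w \<noteq> 0 \<and> (\<forall>v\<in>G. cinner w v = 0)" by auto
qed

lemma G_inf_orth_compl:
  assumes "X \<in> G_inf" shows "orth_compl X \<in> G_inf"
  using assms by (intro G_infI closed_csubspace_orth_compl)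
    (auto simp: orth_compl_orth_compl G_infD)

lemma G_inf_Int_orth_compl:
  assumes "X \<in> G_inf" "finite F" shows "X \<inter> orth_compl F \<in> G_inf"
proof (rule G_infI)
  show "closed_csubspace (X \<inter> orth_compl F)"
    by (intro closed_csubspace_Int closed_csubspace_orth_compl G_inf_closed assms)
  show "meets_fin_orth (X \<inter> orth_compl F)"
    by (intro meets_fin_orth_Int_orth_compl G_inf_meets assms)
  show "meets_fin_orth (orth_compl (X \<inter> orth_compl F))"
    by (rule meets_fin_orth_mono[OF G_inf_orth_meets[OF assms(1)]]) (simp add: orth_compl_antimono)
qed

lemma G_inf_adjoin:
  assumes "X \<in> G_inf" "p \<in> orth_compl X" shows "adjoin X p \<in> G_inf"
proof (rule G_infI)
  show "closed_csubspace (adjoin X p)" using assms by (simp add: closed_csubspace_adjoin G_infD)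
  show "meets_fin_orth (adjoin X p)"
    using assms by (meson G_inf_meets adjoin_superset meets_fin_orth_mono)
  show "meets_fin_orth (orth_compl (adjoin X p))"
    using assms by (simp add: orth_compl_adjoin G_infD meets_fin_orth_Int_orth_compl)
qed

text \<open>Choosing vectors \<open>x\<^sub>n \<in> X\<close>, \<open>y\<^sub>n \<in> Y\<close>, \<open>z\<^sub>n\<close> in turn, orthogonal to all previous ones
  and with every \<open>z\<^sub>n\<close> also orthogonal to \<open>x\<^sub>n\<close> and \<open>y\<^sub>n\<close>, one may take for \<open>W\<close> the orthogonal
  complement of all \<open>z\<^sub>n\<close>.\<close>

lemma G_inf_common_reduction:
  assumes "csubspace X" "meets_fin_orth X" "csubspace Y" "meets_fin_orth Y"
  obtains W where "W \<in> G_inf" "meets_fin_orth (X \<inter> W)" "meets_fin_orth (Y \<inter> W)"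
proof -
  note X = assms(1,2) and Y = assms(3,4)
  define P where "P = (\<lambda>(F, x, y, z). finite F \<and> x \<in> X \<and> y \<in> Y \<and> x \<noteq> 0 \<and> y \<noteq> 0 \<and> z \<noteq> 0 \<and>
    (\<forall>v\<in>F. cinner x v = 0 \<and> cinner y v = 0) \<and> (\<forall>v\<in>insert x (insert y F). cinner z v = 0))"
  define N where "N = (\<lambda>(F, x, y, z). insert x (insert y (insert z F)) :: 'a set)"
  have ex: "\<exists>x y z. P (F, x, y, z)" if "finite F" for F
  proof -
    obtain x y where xy: "x \<in> X" "x \<noteq> 0" "\<forall>v\<in>F. cinner x v = 0" "y \<in> Y" "y \<noteq> 0" "\<forall>v\<in>F. cinner y v = 0"
      using X(2) Y(2) \<open>finite F\<close> unfolding meets_fin_orth_def by meson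
    have "finite (insert x (insert y F))" using \<open>finite F\<close> by simp
    then obtain z where "z \<noteq> 0" "\<forall>v\<in>insert x (insert y F). cinner z v = 0"
      using X(2) unfolding meets_fin_orth_def by meson
    with xy \<open>finite F\<close> have "P (F, x, y, z)" unfolding P_def by auto
    then show ?thesis by blast
  qed
  have "\<exists>s. \<forall>n. P (s n) \<and> fst (s (Suc n)) = N (s n)"
  proof (rule dependent_nat_choice)
    show "\<exists>s. P s" using ex[of "{}"] by blast
    fix s assume "P s"
    then have "finite (N s)" by (auto simp: P_def N_def)
    then obtain x y z where "P (N s, x, y, z)" using ex by blast
    then show "\<exists>t. P t \<and> fst t = N s" by (intro exI[of _ "(N s, x, y, z)"]) simp
  qed
  then obtain s where s: "\<And>n. P (s n)" "\<And>n. fst (s (Suc n)) = N (s n)" by blast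
  define F x y z where "F = (\<lambda>n. fst (s n))" and "x = (\<lambda>n. fst (snd (s n)))"
    and "y = (\<lambda>n. fst (snd (snd (s n))))" and "z = (\<lambda>n. snd (snd (snd (s n))))"
  have FS: "F (Suc n) = insert (x n) (insert (y n) (insert (z n) (F n)))" for n
    using s(2)[of n] by (simp add: F_def x_def y_def z_def N_def case_prod_beta)
  have hist: "x m \<in> F n \<and> y m \<in> F n \<and> z m \<in> F n" if "m < n" for m n
    using that by (induction n) (auto simp: FS less_Suc_eq)
  have props: "x n \<in> X" "y n \<in> Y" "x n \<noteq> 0" "y n \<noteq> 0" "z n \<noteq> 0" for n
    using s(1)[of n] by (simp_all add: P_def x_def y_def z_def case_prod_beta)
  have orth: "cinner (x n) v = 0" "cinner (y n) v = 0" "cinner (z n) v = 0" if "v \<in> F n" for n v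
    using s(1)[of n] that by (simp_all add: P_def x_def y_def z_def F_def case_prod_beta)
  have orth': "cinner (z n) (x n) = 0" "cinner (z n) (y n) = 0" for n
    using s(1)[of n] by (simp_all add: P_def x_def y_def z_def case_prod_beta)
  define W where "W = orth_compl (range z)"
  have xW: "x m \<in> W" and yW: "y m \<in> W" for m
  proof -
    \<comment> \<open>For \<open>m < n\<close> the vector \<open>z n\<close> was chosen orthogonal
      to \<open>x m\<close> and \<open>y m\<close>, for \<open>n < m\<close> the other way round;
      the case \<open>m = n\<close> is why \<open>z n\<close> comes last in its round.\<close>
    have "cinner (z n) (x m) = 0 \<and> cinner (z n) (y m) = 0" for n
      using orth(3)[of "x m" n] orth(3)[of "y m" n] orth(1,2)[of "z n" m] orth'[of n] hist[of m n] hist[of n m]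
        cinner_eq_0_commute[of "x m" "z n"] cinner_eq_0_commute[of "y m" "z n"]
      by (cases m n rule: linorder_cases) auto
    then show "x m \<in> W" "y m \<in> W" by (auto simp: W_def orth_compl_def)
  qed
  have W: "csubspace W" "closed_csubspace W"
    by (simp_all add: W_def csubspace_orth_compl closed_csubspace_orth_compl)
  have XW: "meets_fin_orth (X \<inter> W)"
    by (intro infinite_cdim_meets_fin_orth csubspace_Int X W infinite_cdim_orthogonal_sequence[of x])
       (auto simp: props xW orth hist)
  have YW: "meets_fin_orth (Y \<inter> W)"
    by (intro infinite_cdim_meets_fin_orth csubspace_Int Y W infinite_cdim_orthogonal_sequence[of y])
       (auto simp: props yW orth hist)
  have "z n \<in> orth_compl W" for n
    using orth_compl_orth_compl_superset[of "range z"] by (auto simp: W_def)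
  then have "meets_fin_orth (orth_compl W)"
    by (intro infinite_cdim_meets_fin_orth csubspace_orth_compl infinite_cdim_orthogonal_sequence[of z])
       (auto simp: props orth hist)
  then have "W \<in> G_inf"
    using W XW by (intro G_infI) (auto intro: meets_fin_orth_mono)
  then show thesis using XW YW that by blast
qed

text \<open>In \<open>adjoin S t\<close> the vectors orthogonal to \<open>S\<close> form just the
  line of \<open>t\<close>, so this line can be recovered from the two subspaces.\<close>

lemma adjoin_orth_unique:
  assumes S: "csubspace S" and t: "t \<in> orth_compl S" "t' \<in> orth_compl S" "t' \<in> adjoin S t"
  shows "\<exists>c. t' = scaleC c t"
proof -
  obtain s c where s: "s \<in> S" "t' = s + scaleC c t" using t(3) by (rule adjoinE)
  have "t' - scaleC c t \<in> orth_compl S"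
    by (intro csubspace_diff csubspace_scaleC csubspace_orth_compl t)
  then have "cinner s s = 0" using s by (intro orth_complD[of s S s]) simp_all
  then show ?thesis using s by auto
qed

lemma adjoin_scaleC:
  assumes "c \<noteq> 0" shows "adjoin S (scaleC c t) = adjoin S t"
proof (intro set_eqI iffI)
  fix y
  assume "y \<in> adjoin S (scaleC c t)"
  then show "y \<in> adjoin S t" by (auto simp: adjoin_def scaleC_scaleC)
next
  fix y
  assume "y \<in> adjoin S t"
  then obtain a where "y - scaleC a t \<in> S" by (auto simp: adjoin_def)
  then show "y \<in> adjoin S (scaleC c t)"
    using assms by (auto simp: adjoin_def scaleC_scaleC intro!: exI[of _ "a / c"])
qed

lemma subset_orth_compl_commute: "X \<subseteq> orth_compl Y \<longleftrightarrow> Y \<subseteq> orth_compl X"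
proof -
  have "B \<subseteq> orth_compl A" if "A \<subseteq> orth_compl B" for A B :: "'a set"
  proof (intro subsetI orth_complI)
    fix y x assume "y \<in> B" "x \<in> A"
    then show "cinner y x = 0" using orth_complD[of x B y] that by blast
  qed
  then show ?thesis by blast
qed

lemma image_subset_orth_compl_iff:
  assumes "semi_isometry L"
  shows "L ` X \<subseteq> orth_compl (L ` Y) \<longleftrightarrow> X \<subseteq> orth_compl Y"
  by (auto simp: orth_compl_def semi_isometry_orth[OF assms])

lemma image_subset_image_iff:
  assumes "semi_isometry L"
  shows "L ` X \<subseteq> L ` Y \<longleftrightarrow> X \<subseteq> Y"
  by (rule inj_image_subset_iff[OF semi_isometry_inj[OF assms]])

lemma image_adjoin:
  assumes "linear_isometry L"
  shows "L ` adjoin X p = adjoin (L ` X) (L p)"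
proof (intro set_eqI iffI)
  note L = linear_isometry_semi[OF assms]
  fix y
  assume "y \<in> L ` adjoin X p"
  then obtain z where z: "y = L z" "z \<in> adjoin X p" by blast
  then obtain c where "z - scaleC c p \<in> X" by (auto simp: adjoin_def)
  then have "y - scaleC c (L p) \<in> L ` X"
    using imageI[of "z - scaleC c p" X L] z(1)
    by (simp add: semi_isometry_diff[OF L] linear_isometry_scaleC[OF assms])
  then show "y \<in> adjoin (L ` X) (L p)" by (auto simp: adjoin_def)
next
  note L = linear_isometry_semi[OF assms]
  fix y
  assume "y \<in> adjoin (L ` X) (L p)"
  then obtain v c where v: "v \<in> L ` X" "y = v + scaleC c (L p)" by (rule adjoinE)
  then obtain x where x: "x \<in> X" "v = L x" by blast
  then have "y = L (x + scaleC c p)"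
    using v(2) by (simp add: semi_isometry_add[OF L] linear_isometry_scaleC[OF assms])
  moreover have "x + scaleC c p \<in> adjoin X p"
    using x(1) by (auto simp: adjoin_def intro!: exI[of _ c])
  ultimately show "y \<in> L ` adjoin X p" by blast
qed

lemma adjoin_Int:
  assumes "csubspace Z" "X \<subseteq> Z" "p \<in> orth_compl Z"
  shows "adjoin X p \<inter> Z = X"
proof
  show "X \<subseteq> adjoin X p \<inter> Z" using adjoin_superset assms(2) by blast
  show "adjoin X p \<inter> Z \<subseteq> X"
  proof
    fix y assume y: "y \<in> adjoin X p \<inter> Z"
    then obtain x c where x: "x \<in> X" "y = x + scaleC c p" by (auto elim: adjoinE)
    then have "scaleC c p \<in> Z"
      using csubspace_diff[OF assms(1), of y x] y assms(2) by auto
    then have "cinner (scaleC c p) p = 0" by (rule orth_complD[OF assms(3)])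
    then show "y \<in> X" using x by auto
  qed
qed

section \<open>The map induced on lines\<close>

locale pair_preserver =
  fixes f :: "'a::complex_hilbert set \<Rightarrow> 'a set"
  assumes infinite_UNIV: "infinite_cdim (UNIV :: 'a set)"
    and maps: "X \<in> G_inf \<Longrightarrow> f X \<in> G_inf"
    and pairs: "preserves_pair_equivalence f"
begin

lemma pairE:
  assumes "X \<in> G_inf" "Y \<in> G_inf"
  obtains L where "linear_isometry L" "f X = L ` X \<and> f Y = L ` Y \<or> f X = L ` Y \<and> f Y = L ` X"
proof -
  obtain L where L: "linear_isometry L" "{f X, f Y} = {L ` X, L ` Y}"
    using pairs assms unfolding preserves_pair_equivalence_def by meson
  then show thesis using that[OF L(1)] by (simp add: doubleton_eq_iff)
qed

lemma f_orth_iff: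
  assumes "X \<in> G_inf" "Y \<in> G_inf"
  shows "f X \<subseteq> orth_compl (f Y) \<longleftrightarrow> X \<subseteq> orth_compl Y"
proof -
  obtain L where L: "linear_isometry L" "f X = L ` X \<and> f Y = L ` Y \<or> f X = L ` Y \<and> f Y = L ` X"
    using pairE[OF assms] .
  from L(2) show ?thesis
    by (elim disjE conjE)
       (simp_all add: image_subset_orth_compl_iff[OF linear_isometry_semi[OF L(1)]] subset_orth_compl_commute[of X Y])
qed

text \<open>A swap may reverse an inclusion, so at this stage comparability is preserved without its
  direction.\<close>

lemma f_comparable:
  assumes "X \<in> G_inf" "Y \<in> G_inf"
  shows "f X \<subseteq> f Y \<or> f Y \<subseteq> f X \<longleftrightarrow> X \<subseteq> Y \<or> Y \<subseteq> X"
proof -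
  obtain L where L: "linear_isometry L" "f X = L ` X \<and> f Y = L ` Y \<or> f X = L ` Y \<and> f Y = L ` X"
    using pairE[OF assms] .
  from L(2) show ?thesis
    by (elim disjE conjE) (auto simp: image_subset_image_iff[OF linear_isometry_semi[OF L(1)]])
qed

lemma f_inj:
  assumes "X \<in> G_inf" "Y \<in> G_inf" "f X = f Y" shows "X = Y"
proof -
  obtain L where L: "linear_isometry L" "f X = L ` X \<and> f Y = L ` Y \<or> f X = L ` Y \<and> f Y = L ` X"
    using pairE[OF assms(1,2)] .
  have "L ` X = L ` Y" using L(2) assms(3) by auto
  then show ?thesis using inj_image_eq_iff[OF semi_isometry_inj[OF linear_isometry_semi[OF L(1)]]] by simp
qed

text \<open>The order of the pair cannot be reversed: the complement of \<open>Y\<close> is orthogonal to \<open>Y\<close>,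
  but not to any proper superset of \<open>Y\<close>.\<close>

lemma f_mono:
  assumes X: "X \<in> G_inf" and Y: "Y \<in> G_inf" and "Y \<subseteq> X"
  shows "f Y \<subseteq> f X"
proof (rule ccontr)
  assume "\<not> f Y \<subseteq> f X"
  then have sub: "f X \<subseteq> f Y" using f_comparable[OF X Y] assms(3) by blast
  have Z: "orth_compl Y \<in> G_inf" using Y by (rule G_inf_orth_compl)
  have "f (orth_compl Y) \<subseteq> orth_compl (f Y)" using f_orth_iff[OF Z Y] by simp
  then have "f (orth_compl Y) \<subseteq> orth_compl (f X)" using orth_compl_antimono[OF sub] by blast
  then have "orth_compl Y \<subseteq> orth_compl X" using f_orth_iff[OF Z X] by simp
  then have "X \<subseteq> Y"
    using subset_orth_compl_commute[of "orth_compl Y" X] orth_compl_orth_compl[OF G_inf_closed[OF Y]] by simp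
  then show False using assms(3) \<open>\<not> f Y \<subseteq> f X\<close> by simp
qed

lemma f_subset_iff:
  assumes X: "X \<in> G_inf" and Y: "Y \<in> G_inf"
  shows "f Y \<subseteq> f X \<longleftrightarrow> Y \<subseteq> X"
proof
  assume *: "f Y \<subseteq> f X"
  then consider "Y \<subseteq> X" | "X \<subseteq> Y" using f_comparable[OF X Y] by blast
  then show "Y \<subseteq> X"
  proof cases
    case 2
    then have "f X = f Y" using f_mono[OF Y X] * by blast
    then show ?thesis using f_inj[OF X Y] by simp
  qed
qed (rule f_mono[OF X Y])

text \<open>Fixing the norm determines \<open>t\<close> up to a phase and forces
  \<open>t = 0\<close> when \<open>p = 0\<close>.\<close>

definition line_image :: "'a \<Rightarrow> 'a set \<Rightarrow> 'a \<Rightarrow> bool" where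
  "line_image p X t \<longleftrightarrow> norm t = norm p \<and> t \<in> orth_compl (f X) \<and> f (adjoin X p) = adjoin (f X) t"

lemma line_image_exists:
  assumes X: "X \<in> G_inf" and p: "p \<in> orth_compl X"
  obtains t where "line_image p X t"
proof -
  have A: "adjoin X p \<in> G_inf" using G_inf_adjoin[OF X p] .
  obtain L where L: "linear_isometry L"
    "f X = L ` X \<and> f (adjoin X p) = L ` adjoin X p \<or> f X = L ` adjoin X p \<and> f (adjoin X p) = L ` X"
    using pairE[OF X A] .
  note L' = linear_isometry_semi[OF L(1)]
  \<comment> \<open>If the pair were swapped, this inclusion and monotonicity of \<open>f\<close>
    would be opposite; then both images coincide and the unswapped equations hold as well.\<close>
  have "L ` X \<subseteq> L ` adjoin X p" using adjoin_superset by blast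
  moreover have "f X \<subseteq> f (adjoin X p)" using f_mono[OF A X adjoin_superset] .
  ultimately have eq: "f X = L ` X" "f (adjoin X p) = L ` adjoin X p" using L(2) by blast+
  have "L p \<in> orth_compl (f X)"
    unfolding eq using image_subset_orth_compl_iff[OF L', of "{p}" X] p by simp
  then have "line_image p X (L p)"
    using eq by (simp add: line_image_def semi_isometry_norm[OF L'] image_adjoin[OF L(1)])
  then show thesis using that by blast
qed

lemma line_image_unique:
  assumes X: "X \<in> G_inf" and t: "line_image p X t"
    and t': "t' \<in> orth_compl (f X)" "t' \<in> f (adjoin X p)"
  shows "\<exists>c. t' = scaleC c t"
  using adjoin_orth_unique[OF G_inf_csubspace[OF maps[OF X]], of t t'] t t'
  by (simp add: line_image_def)

lemma line_image_scaleC: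
  assumes "line_image p X t" "norm (scaleC c t) = norm p"
  shows "line_image p X (scaleC c t)"
proof (cases "c = 0")
  case True
  then have "norm p = 0" using assms(2) by simp
  then have "t = 0" using assms(1) by (simp add: line_image_def)
  then show ?thesis using assms(1) by simp
next
  case False
  then show ?thesis
    using assms by (simp add: line_image_def adjoin_scaleC csubspace_scaleC[OF csubspace_orth_compl])
qed

text \<open>Consider the pair \<open>adjoin X p\<close> and \<open>Z\<close>. It intersects in
  \<open>X\<close>, and an intersection does not notice a swap, so the isometry \<open>L\<close> of
  this pair carries \<open>X\<close> to \<open>f X\<close>. Then \<open>L p\<close> is orthogonal to
  \<open>f X\<close>, and either order of the pair gives the claim.\<close>

lemma line_image_orth_superset:
  assumes X: "X \<in> G_inf" and Z: "Z \<in> G_inf" and XZ: "X \<subseteq> Z" and p: "p \<in> orth_compl Z"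
    and t: "line_image p X t"
  shows "t \<in> orth_compl (f Z)"
proof (cases "p = 0")
  case True
  then have "t = 0" using t by (simp add: line_image_def)
  then show ?thesis by (simp add: orth_compl_def)
next
  case False
  let ?A = "adjoin X p"
  have pX: "p \<in> orth_compl X" using p orth_compl_antimono[OF XZ] by blast
  have A: "?A \<in> G_inf" using G_inf_adjoin[OF X pX] .
  have fA: "f ?A = adjoin (f X) t" and tX: "t \<in> orth_compl (f X)" using t by (simp_all add: line_image_def)
  have "0 \<in> X" "0 \<in> f X"
    using csubspace_0[OF G_inf_csubspace[OF X]] csubspace_0[OF G_inf_csubspace[OF maps[OF X]]] .
  have fXZ: "f X \<subseteq> f Z" using f_mono[OF Z X XZ] .
  have "\<not> ?A \<subseteq> Z"
  proof
    assume "?A \<subseteq> Z"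
    then have "p \<in> Z" using mem_adjoin[OF \<open>0 \<in> X\<close>] by blast
    then have "cinner p p = 0" by (rule orth_complD[OF p])
    then show False using False by simp
  qed
  then have nsub: "\<not> f ?A \<subseteq> f Z" using f_subset_iff[OF Z A] by simp
  obtain L where L: "linear_isometry L"
    "f ?A = L ` ?A \<and> f Z = L ` Z \<or> f ?A = L ` Z \<and> f Z = L ` ?A"
    using pairE[OF A Z] .
  note L' = linear_isometry_semi[OF L(1)]
  have "f ?A \<inter> f Z = L ` (?A \<inter> Z)"
    using L(2) image_Int[OF semi_isometry_inj[OF L']] by blast
  then have int: "f ?A \<inter> f Z = L ` X"
    by (simp add: adjoin_Int[OF G_inf_csubspace[OF Z] XZ p])
  have "f ?A \<inter> f Z \<subseteq> f X"
  proof
    fix u assume u: "u \<in> f ?A \<inter> f Z"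
    then obtain y c where y: "y \<in> f X" "u = y + scaleC c t" unfolding fA by (auto elim: adjoinE)
    note fZ = G_inf_csubspace[OF maps[OF Z]]
    have "scaleC c t \<in> f Z" using csubspace_diff[OF fZ, of u y] y u fXZ by auto
    \<comment> \<open>Otherwise \<open>t\<close> lies in \<open>f Z\<close>, and then
      \<open>f Z\<close> contains \<open>f ?A\<close> although \<open>Z\<close> does not contain
      \<open>?A\<close>.\<close>
    then have "c = 0"
      using nsub adjoin_subset[OF fZ fXZ] csubspace_scaleC_cancel[OF fZ] unfolding fA by blast
    then show "u \<in> f X" using y by simp
  qed
  moreover have "f X \<subseteq> f ?A" unfolding fA by (rule adjoin_superset)
  ultimately have fX: "f X = L ` X" using int fXZ by blast
  have Lp: "L p \<in> orth_compl (L ` Z)" "L p \<in> orth_compl (L ` X)"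
    using image_subset_orth_compl_iff[OF L', of "{p}"] p pX by simp_all
  have tA: "t \<in> f ?A" unfolding fA using mem_adjoin[OF \<open>0 \<in> f X\<close>] .
  from L(2) show ?thesis
  proof
    assume *: "f ?A = L ` ?A \<and> f Z = L ` Z"
    then have "t \<in> adjoin (f X) (L p)" using tA by (simp add: image_adjoin[OF L(1)] fX)
    then obtain c where "t = scaleC c (L p)"
      using adjoin_orth_unique[OF G_inf_csubspace[OF maps[OF X]] Lp(2)[folded fX] tX] by blast
    then show ?thesis using Lp(1) * by (simp add: csubspace_scaleC[OF csubspace_orth_compl])
  next
    \<comment> \<open>Now \<open>t\<close> lies in the image of \<open>Z\<close>, to which
      \<open>L p\<close> is orthogonal, while \<open>f Z\<close> is the sum of \<open>f X\<close>
      and the line of \<open>L p\<close>; so \<open>t\<close> is orthogonal to both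
      summands.\<close>
    assume *: "f ?A = L ` Z \<and> f Z = L ` ?A"
    then have "cinner t (L p) = 0" using orth_complD[OF Lp(1)] tA by simp
    then have "t \<in> orth_compl {L p}" using cinner_eq_0_commute[of t "L p"] by (simp add: orth_compl_def)
    then show ?thesis
      using * tX by (simp add: image_adjoin[OF L(1)] orth_compl_adjoin[OF G_inf_csubspace[OF maps[OF X]]] flip: fX)
  qed
qed

lemma line_image_superset_unique:
  assumes X: "X \<in> G_inf" and Z: "Z \<in> G_inf" and XZ: "X \<subseteq> Z" and p: "p \<in> orth_compl Z"
    and t: "line_image p X t" and t': "line_image p Z t'"
  shows "\<exists>c. t = scaleC c t'" "\<exists>c. t' = scaleC c t"
proof -
  have pX: "p \<in> orth_compl X" using p orth_compl_antimono[OF XZ] by blast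
  have "t \<in> f (adjoin X p)"
    using t mem_adjoin[OF csubspace_0[OF G_inf_csubspace[OF maps[OF X]]]] by (simp add: line_image_def)
  then have "t \<in> f (adjoin Z p)"
    using f_mono[OF G_inf_adjoin[OF Z p] G_inf_adjoin[OF X pX] adjoin_mono[OF XZ]] by blast
  then show "\<exists>c. t = scaleC c t'"
    using line_image_unique[OF Z t' line_image_orth_superset[OF X Z XZ p t]] by blast
  then obtain c where c: "t = scaleC c t'" ..
  have n: "norm t = norm p" "norm t' = norm p" using t t' by (simp_all add: line_image_def)
  show "\<exists>c. t' = scaleC c t"
  proof (cases "c = 0")
    case True
    then have "t' = 0" using n c by simp
    then show ?thesis by (intro exI[of _ 0]) simp
  next
    case False
    then show ?thesis using c by (intro exI[of _ "inverse c"]) (simp add: scaleC_scaleC)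
  qed
qed

text \<open>Suitable vectors exist for \<open>X\<close> and for \<open>Z\<close>, monotonicity of
  \<open>f\<close> makes them collinear, and any vector of the right norm on the line
  qualifies.\<close>

lemma line_image_subset_iff:
  assumes X: "X \<in> G_inf" and Z: "Z \<in> G_inf" and XZ: "X \<subseteq> Z" and p: "p \<in> orth_compl Z"
  shows "line_image p X t \<longleftrightarrow> line_image p Z t"
proof
  have pX: "p \<in> orth_compl X" using p orth_compl_antimono[OF XZ] by blast
  show "line_image p Z t" if t: "line_image p X t"
  proof -
    obtain t' where t': "line_image p Z t'" using line_image_exists[OF Z p] .
    obtain c where c: "t = scaleC c t'" using line_image_superset_unique(1)[OF X Z XZ p t t'] ..
    show ?thesis using line_image_scaleC[OF t', of c] t unfolding c by (simp add: line_image_def)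
  qed
  show "line_image p X t" if t: "line_image p Z t"
  proof -
    obtain t' where t': "line_image p X t'" using line_image_exists[OF X pX] .
    obtain c where c: "t = scaleC c t'" using line_image_superset_unique(2)[OF X Z XZ p t' t] ..
    show ?thesis using line_image_scaleC[OF t', of c] t unfolding c by (simp add: line_image_def)
  qed
qed

text \<open>The link is \<open>X \<supseteq> X \<inter> W \<subseteq> W \<supseteq> Y \<inter> W
  \<subseteq> Y\<close>, with all five members in \<open>G_inf\<close> and orthogonal to
  \<open>p\<close>.\<close>

lemma line_image_independent:
  assumes X: "X \<in> G_inf" and Y: "Y \<in> G_inf" and p: "p \<in> orth_compl X" "p \<in> orth_compl Y"
    and t: "line_image p X t"
  shows "line_image p Y t"
proof -
  obtain V where V: "V \<in> G_inf" "meets_fin_orth (X \<inter> V)" "meets_fin_orth (Y \<inter> V)"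
    using G_inf_common_reduction[OF G_inf_csubspace[OF X] G_inf_meets[OF X] G_inf_csubspace[OF Y] G_inf_meets[OF Y]] .
  define W where "W = V \<inter> orth_compl {p}"
  have W: "W \<in> G_inf" unfolding W_def using V(1) by (rule G_inf_Int_orth_compl) simp
  have pW: "p \<in> orth_compl W"
    using subset_orth_compl_commute[of W "{p}"] by (simp add: W_def)
  have iff: "line_image p U t \<longleftrightarrow> line_image p W t"
    if U: "U \<in> G_inf" "p \<in> orth_compl U" "meets_fin_orth (U \<inter> V)" for U
  proof -
    \<comment> \<open>Making \<open>W\<close> orthogonal to \<open>p\<close> costs nothing inside
      \<open>U\<close>, which is orthogonal to \<open>p\<close> already.\<close>
    have "U \<inter> W = U \<inter> V"
      using U(2) subset_orth_compl_commute[of "{p}" U] by (auto simp: W_def)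
    then have "meets_fin_orth (U \<inter> W)" using U(3) by simp
    moreover have "meets_fin_orth (orth_compl (U \<inter> W))"
      by (rule meets_fin_orth_mono[OF G_inf_orth_meets[OF U(1)]]) (simp add: orth_compl_antimono)
    ultimately have UW: "U \<inter> W \<in> G_inf"
      by (rule G_infI[OF closed_csubspace_Int[OF G_inf_closed[OF U(1)] G_inf_closed[OF W]]])
    show ?thesis
      using line_image_subset_iff[OF UW U(1) _ U(2)] line_image_subset_iff[OF UW W _ pW] by simp
  qed
  show ?thesis using iff[OF X p(1) V(2)] iff[OF Y p(2) V(3)] t by simp
qed

text \<open>Common reduction of \<open>UNIV\<close> with itself yields a member of
  \<open>G_inf\<close>, which is then cut down by the complement of \<open>F\<close>. Thus every
  \<open>p\<close> has subspaces from which its line image can be read off.\<close>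

lemma G_inf_avoiding:
  assumes "finite (F :: 'a set)" obtains X where "X \<in> G_inf" "F \<subseteq> orth_compl X"
proof -
  have U: "csubspace (UNIV :: 'a set)" using closed_csubspace_UNIV by (rule closed_csubspace_csubspace)
  note M = infinite_cdim_meets_fin_orth[OF U infinite_UNIV]
  obtain V :: "'a set" where V: "V \<in> G_inf"
    using G_inf_common_reduction[OF U M U M] by blast
  have "F \<subseteq> orth_compl (V \<inter> orth_compl F)"
    using subset_orth_compl_commute[of "V \<inter> orth_compl F" F] by simp
  then show thesis using that[OF G_inf_Int_orth_compl[OF V assms]] by blast
qed

text \<open>One choice serves all \<open>X\<close>, but the phase is arbitrary for each
  \<open>p\<close>, so \<open>T\<close> is not yet expected to be additive; Wigner's theorem repairs
  the phases.\<close>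

definition T :: "'a \<Rightarrow> 'a" where
  "T p = (SOME t. \<forall>X\<in>G_inf. p \<in> orth_compl X \<longrightarrow> line_image p X t)"

lemma line_image_T:
  assumes "X \<in> G_inf" "p \<in> orth_compl X" shows "line_image p X (T p)"
proof -
  obtain t where "line_image p X t" using line_image_exists[OF assms] .
  then have "\<forall>Y\<in>G_inf. p \<in> orth_compl Y \<longrightarrow> line_image p Y t"
    using line_image_independent[OF assms(1) _ assms(2)] by blast
  then have "\<forall>X\<in>G_inf. p \<in> orth_compl X \<longrightarrow> line_image p X (T p)"
    unfolding T_def by (rule someI)
  then show ?thesis using assms by blast
qed

lemma T_norm: "norm (T p) = norm p"
proof -
  obtain X where "X \<in> G_inf" "{p} \<subseteq> orth_compl X" using G_inf_avoiding[of "{p}"] by auto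
  then show ?thesis using line_image_T[of X p] by (simp add: line_image_def)
qed

lemma T_orth: "X \<in> G_inf \<Longrightarrow> p \<in> orth_compl X \<Longrightarrow> T p \<in> orth_compl (f X)"
  and f_adjoin: "X \<in> G_inf \<Longrightarrow> p \<in> orth_compl X \<Longrightarrow> f (adjoin X p) = adjoin (f X) (T p)"
  using line_image_T[of X p] by (simp_all add: line_image_def)

text \<open>\<open>X\<close> contains the sum of its part orthogonal to \<open>p\<close> and the
  line of \<open>p\<close>; the line which \<open>f\<close> adds to the image of that part is that
  of \<open>T p\<close>.\<close>

lemma T_mem:
  assumes X: "X \<in> G_inf" and p: "p \<in> X" shows "T p \<in> f X"
proof -
  let ?X = "X \<inter> orth_compl {p}"
  have X': "?X \<in> G_inf" using X by (rule G_inf_Int_orth_compl) simp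
  have p': "p \<in> orth_compl ?X"
    using subset_orth_compl_commute[of ?X "{p}"] by simp
  have "T p \<in> f (adjoin ?X p)"
    using f_adjoin[OF X' p'] mem_adjoin[OF csubspace_0[OF G_inf_csubspace[OF maps[OF X']]]] by simp
  moreover have "f (adjoin ?X p) \<subseteq> f X"
    using f_mono[OF X G_inf_adjoin[OF X' p']] adjoin_subset[OF G_inf_csubspace[OF X] _ p, of ?X] by simp
  ultimately show ?thesis by blast
qed

end

lemma cmod_cinner_scaleC_self: "cmod (cinner u (scaleC c u)) = norm u * norm (scaleC c u)"
  by (simp add: norm_mult cinner_self norm_scaleC norm_power power2_eq_square)

section \<open>Wigner's theorem\<close>

text \<open>Bargmann's argument: with phases normalised against a fixed unit vector \<open>e\<close>, the map on the
  orthogonal complement of \<open>e\<close> preserves both \<open>|\<langle>p, q\<rangle>|\<close> and \<open>|1 + \<langle>p, q\<rangle>|\<close>, hence the real inner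
  product. So it is real linear, and multiplication by \<open>\<i>\<close> goes to multiplication by \<open>\<plusminus>\<i>\<close>, where
  the sign is constant because a group is not the union of two proper subgroups.\<close>

theorem wigner:
  fixes T :: "'a::complex_hilbert \<Rightarrow> 'a" and e :: 'a
  assumes T: "\<And>p q. cmod (cinner (T p) (T q)) = cmod (cinner p q)"
    and e: "norm e = 1"
  obtains L where "semi_isometry L" "\<And>p. \<exists>c. L p = scaleC c (T p)"
proof -
  have nT: "norm (T p) = norm p" for p
    using T[of p p] by (simp add: cinner_self norm_power)
  have T_line: "\<exists>d. T (scaleC c p) = scaleC d (T p)" if "p \<noteq> 0" for c p
  proof (rule cinner_collinear)
    show "cmod (cinner (T p) (T (scaleC c p))) = norm (T p) * norm (T (scaleC c p))"
      unfolding T nT by (rule cmod_cinner_scaleC_self)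
    show "T p \<noteq> 0" using nT[of p] that by auto
  qed
  have ee: "cinner e e = 1" "cinner (T e) (T e) = 1" by (simp_all add: cinner_self nT e)
  \<comment> \<open>For \<open>p\<close> orthogonal to \<open>e\<close>, multiplying
    \<open>T (e + p)\<close> by the conjugate of \<open>k p\<close> makes its coefficient along
    \<open>T e\<close> equal to 1; \<open>V p\<close> is what remains.\<close>
  define k where "k p = cinner (T (e + p)) (T e)" for p
  define V where "V p = scaleC (cnj (k p)) (T (e + p)) - T e" for p
  have V_eq: "T e + V p = scaleC (cnj (k p)) (T (e + p))" for p by (simp add: V_def)
  have k: "cmod (k p) = 1" if "cinner p e = 0" for p
    using that by (simp add: k_def T cinner_add_left ee)
  have Ve: "cinner (V p) (T e) = 0" if "cinner p e = 0" for p
    using complex_norm_square[of "k p"] k[OF that]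
    by (simp add: V_def cinner_diff_left ee mult.commute flip: k_def)
  have eV: "cinner (T e) (V p) = 0" if "cinner p e = 0" for p
    using Ve[OF that] cinner_eq_0_commute[of "V p" "T e"] by simp
  have ep: "cinner e p = 0" if "cinner p e = 0" for p
    using that cinner_eq_0_commute[of p e] by simp
  have A: "cmod (1 + cinner (V p) (V q)) = cmod (1 + cinner p q)"
    if "cinner p e = 0" "cinner q e = 0" for p q
  proof -
    have "1 + cinner (V p) (V q) = cinner (T e + V p) (T e + V q)"
      by (simp add: cinner_add_left cinner_add_right ee Ve eV that)
    also have "cmod \<dots> = cmod (cinner (e + p) (e + q))"
      unfolding V_eq by (simp add: norm_mult k that T)
    also have "cinner (e + p) (e + q) = 1 + cinner p q"
      by (simp add: cinner_add_left cinner_add_right ee ep that)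
    finally show ?thesis .
  qed
  have nV: "norm (V p) = norm p" if "cinner p e = 0" for p
  proof -
    have "cmod (complex_of_real (1 + (norm (V p))\<^sup>2)) = cmod (complex_of_real (1 + (norm p)\<^sup>2))"
      using A[OF that that] by (simp add: cinner_self)
    then have "(norm (V p))\<^sup>2 = (norm p)\<^sup>2" unfolding norm_of_real by simp
    then show ?thesis by simp
  qed
  \<comment> \<open>Equality case of Cauchy-Schwarz: \<open>T p\<close> is orthogonal to
    \<open>T e\<close>, so its product with \<open>V p\<close> has modulus |<p, e + p>|, the squared
    norm of \<open>p\<close>.\<close>
  have V_line: "\<exists>a. V p = scaleC a (T p) \<and> cmod a * norm p = norm p" if "cinner p e = 0" for p
  proof (cases "p = 0")
    case True
    then have "V p = 0" using nV[OF that] by simp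
    then show ?thesis using True by (intro exI[of _ 0]) simp
  next
    case False
    have "cinner (T p) (T e) = 0" using T[of p e] that by simp
    then have "cinner (T p) (V p) = cinner (T p) (T e + V p)" by (simp add: cinner_add_right)
    also have "cmod \<dots> = cmod (cinner p (e + p))" unfolding V_eq by (simp add: norm_mult k that T)
    also have "\<dots> = norm (T p) * norm (V p)"
      by (simp add: cinner_add_right that cinner_self norm_power nT nV power2_eq_square norm_mult)
    finally have "\<exists>a. V p = scaleC a (T p)"
      using False nT[of p] by (intro cinner_collinear) auto
    then obtain a where a: "V p = scaleC a (T p)" ..
    then have "cmod a * norm p = norm p" using nV[OF that] by (simp add: norm_scaleC nT)
    with a show ?thesis by blast
  qed
  have C: "cmod (cinner (V p) (V q)) = cmod (cinner p q)"
    if pq: "cinner p e = 0" "cinner q e = 0" for p q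
  proof (cases "p = 0 \<or> q = 0")
    case True
    then show ?thesis using nV[OF pq(1)] nV[OF pq(2)] by auto
  next
    case False
    obtain a where a: "V p = scaleC a (T p)" "cmod a * norm p = norm p" using V_line[OF pq(1)] by blast
    obtain b where b: "V q = scaleC b (T q)" "cmod b * norm q = norm q" using V_line[OF pq(2)] by blast
    show ?thesis using a b False by (simp add: norm_mult T)
  qed
  have D: "inner (V p) (V q) = inner p q"
    if "cinner p e = 0" "cinner q e = 0" for p q
  proof -
    have exp: "(cmod (1 + z))\<^sup>2 = 1 + 2 * Re z + (cmod z)\<^sup>2" for z
      unfolding cmod_power2 by (simp add: power2_eq_square algebra_simps)
    have "(cmod (1 + cinner (V p) (V q)))\<^sup>2 = (cmod (1 + cinner p q))\<^sup>2" using A[OF that] by simp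
    then show ?thesis unfolding exp C[OF that] Re_cinner by simp
  qed
  have V_add: "V (p + q) = V p + V q" if "cinner p e = 0" "cinner q e = 0" for p q
  proof -
    have pq: "cinner (p + q) e = 0" using that by (simp add: cinner_add_left)
    \<comment> \<open>Expanding leaves inner products of values of \<open>V\<close> only; replacing
      each by that of the arguments gives the squared norm of zero.\<close>
    have "inner (V (p + q) - (V p + V q)) (V (p + q) - (V p + V q))
        = inner ((p + q) - (p + q)) ((p + q) - (p + q))"
      unfolding inner_diff_left inner_diff_right inner_add_left inner_add_right
      by (simp add: D that pq inner_add_left inner_add_right inner_commute)
    then show ?thesis by simp
  qed
  have V_scaleR: "V (r *\<^sub>R p) = r *\<^sub>R V p" if "cinner p e = 0" for p r
  proof -
    have rp: "cinner (r *\<^sub>R p) e = 0" using that by (simp add: scaleR_eq_scaleC)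
    have "inner (V (r *\<^sub>R p) - r *\<^sub>R V p) (V (r *\<^sub>R p) - r *\<^sub>R V p)
        = inner (r *\<^sub>R p - r *\<^sub>R p) (r *\<^sub>R p - r *\<^sub>R p)"
      unfolding inner_diff_left inner_diff_right inner_scaleR_left inner_scaleR_right
      by (simp add: D that rp)
    then show ?thesis by simp
  qed
  have V_i: "V (scaleC \<i> p) = scaleC \<i> (V p) \<or> V (scaleC \<i> p) = scaleC (- \<i>) (V p)"
    if "cinner p e = 0" for p
  proof (cases "p = 0")
    case True
    then have "V p = 0" using nV[OF that] by simp
    then show ?thesis using True by simp
  next
    case False
    have ip: "cinner (scaleC \<i> p) e = 0" using that by simp
    have "cmod (cinner (V p) (V (scaleC \<i> p))) = norm (V p) * norm (V (scaleC \<i> p))"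
      by (simp only: C[OF that ip] nV[OF that] nV[OF ip] cmod_cinner_scaleC_self)
    moreover have "V p \<noteq> 0" using False nV[OF that] by auto
    ultimately obtain c where c: "V (scaleC \<i> p) = scaleC c (V p)" using cinner_collinear by blast
    have "cmod c * norm p = norm p"
      using nV[OF ip] nV[OF that] unfolding c by (simp add: norm_scaleC)
    then have c1: "cmod c = 1" using False by simp
    have "inner (scaleC c (V p)) (V p) = inner (scaleC \<i> p) p"
      unfolding c[symmetric] by (rule D[OF ip that])
    then have "Re (cinner (scaleC c (V p)) (V p)) = Re (cinner (scaleC \<i> p) p)" unfolding Re_cinner .
    then have "Re c * (norm p)\<^sup>2 = 0" by (simp add: cinner_self nV[OF that])
    then have "Re c = 0" using False by simp
    moreover from this have "(Im c)\<^sup>2 = 1" using c1 cmod_power2[of c] by simp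
    then have "Im c = 1 \<or> Im c = -1" by (simp add: power2_eq_1_iff)
    ultimately have "c = \<i> \<or> c = - \<i>" by (auto simp: complex_eq_iff)
    then show ?thesis using c by auto
  qed
  define U where "U s = {p. cinner p e = 0 \<and> V (scaleC \<i> p) = scaleC s (V p)}" for s
  have U_add: "p + q \<in> U s" if "p \<in> U s" "q \<in> U s" for s p q
    using that V_add[of p q] V_add[of "scaleC \<i> p" "scaleC \<i> q"]
    by (simp add: U_def cinner_add_left scaleC_add_right)
  have U_minus: "- p \<in> U s" if "p \<in> U s" for s p
    using that V_scaleR[of p "-1"] V_scaleR[of "scaleC \<i> p" "-1"]
    by (simp add: U_def scaleC_minus_right)
  have U_all: "p \<in> U \<i> \<or> p \<in> U (- \<i>)" if "cinner p e = 0" for p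
    using V_i[OF that] that by (simp add: U_def)
  have "(\<forall>p. cinner p e = 0 \<longrightarrow> p \<in> U \<i>) \<or> (\<forall>p. cinner p e = 0 \<longrightarrow> p \<in> U (- \<i>))"
  proof (rule ccontr)
    assume "\<not> ?thesis"
    then obtain p q where pq: "cinner p e = 0" "p \<notin> U \<i>" "cinner q e = 0" "q \<notin> U (- \<i>)" by blast
    then have mem: "p \<in> U (- \<i>)" "q \<in> U \<i>" using U_all by blast+
    have "cinner (p + q) e = 0" using pq by (simp add: cinner_add_left)
    from U_all[OF this] show False
    proof
      assume "p + q \<in> U \<i>"
      then have "p \<in> U \<i>" using U_add[OF _ U_minus[OF mem(2)], of "p + q"] by simp
      then show False using pq by simp
    next
      assume "p + q \<in> U (- \<i>)"
      then have "q \<in> U (- \<i>)" using U_add[OF _ U_minus[OF mem(1)], of "p + q"] by simp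
      then show False using pq by simp
    qed
  qed
  then obtain s where s: "s = \<i> \<or> s = - \<i>"
    and Vs: "\<And>p. cinner p e = 0 \<Longrightarrow> V (scaleC \<i> p) = scaleC s (V p)"
    unfolding U_def by blast
  define \<sigma> where "\<sigma> a = (if s = \<i> then a else cnj a)" for a
  have \<sigma>: "\<sigma> (a + b) = \<sigma> a + \<sigma> b" "\<sigma> (a * b) = \<sigma> a * \<sigma> b" "cmod (\<sigma> a) = cmod a" for a b
    by (simp_all add: \<sigma>_def)
  have V_scaleC: "V (scaleC a p) = scaleC (\<sigma> a) (V p)" if "cinner p e = 0" for a p
  proof -
    have "cinner (scaleC \<i> p) e = 0" using that by simp
    moreover from this have "cinner (Re a *\<^sub>R p) e = 0" "cinner (Im a *\<^sub>R scaleC \<i> p) e = 0"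
      using that by (simp_all add: scaleR_eq_scaleC)
    ultimately have "V (scaleC a p) = Re a *\<^sub>R V p + Im a *\<^sub>R scaleC s (V p)"
      using that by (subst scaleC_complex) (simp only: V_add V_scaleR Vs)
    also have "\<dots> = scaleC (complex_of_real (Re a) + complex_of_real (Im a) * s) (V p)"
      by (simp add: scaleR_eq_scaleC scaleC_scaleC scaleC_add_left)
    also have "complex_of_real (Re a) + complex_of_real (Im a) * s = \<sigma> a"
      using s by (auto simp: \<sigma>_def complex_eq_iff)
    finally show ?thesis .
  qed
  define P where "P x = x - scaleC (cinner x e) e" for x
  have Pe: "cinner (P x) e = 0" for x by (simp add: P_def cinner_diff_left ee)
  define L where "L x = scaleC (\<sigma> (cinner x e)) (T e) + V (P x)" for x
  have L_add: "L (x + y) = L x + L y" for x y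
  proof -
    have "P (x + y) = P x + P y" by (simp add: P_def cinner_add_left scaleC_add_left)
    then show ?thesis by (simp add: L_def cinner_add_left \<sigma> scaleC_add_left V_add Pe)
  qed
  have L_scaleC: "L (scaleC a x) = scaleC (\<sigma> a) (L x)" for a x
  proof -
    have "P (scaleC a x) = scaleC a (P x)" by (simp add: P_def scaleC_diff_right scaleC_scaleC)
    then show ?thesis by (simp add: L_def \<sigma> V_scaleC Pe scaleC_add_right scaleC_scaleC)
  qed
  have L_norm: "norm (L x) = norm x" for x
  proof -
    have "cinner (scaleC (\<sigma> (cinner x e)) (T e)) (V (P x)) = 0" using eV[OF Pe] by simp
    then have "(norm (L x))\<^sup>2 = (cmod (cinner x e))\<^sup>2 + (norm (P x))\<^sup>2"
      unfolding L_def by (simp add: norm_add_orth norm_scaleC \<sigma> nT e nV[OF Pe])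
    also have "\<dots> = (norm (scaleC (cinner x e) e + P x))\<^sup>2"
      using ep[OF Pe] by (subst norm_add_orth) (simp_all add: norm_scaleC e)
    also have "scaleC (cinner x e) e + P x = x" by (simp add: P_def)
    finally show ?thesis by simp
  qed
  have L_line: "\<exists>c. L x = scaleC c (T x)" for x
  proof (cases "cinner x e = 0")
    case True
    have "\<sigma> 0 = 0" by (simp add: \<sigma>_def)
    then have "L x = V x" using True by (simp add: L_def P_def)
    then show ?thesis using V_line[OF True] by auto
  next
    case False
    define \<alpha> where "\<alpha> = cinner x e"
    have "x \<noteq> 0" using False by auto
    \<comment> \<open>Rescaled to have \<open>e\<close>-coefficient 1, \<open>x\<close> becomes
      \<open>e + q\<close>, the kind of vector through which \<open>V\<close> was defined.\<close>
    define q where "q = scaleC (inverse \<alpha>) (P x)"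
    have q: "cinner q e = 0" by (simp add: q_def Pe)
    have x: "P x = scaleC \<alpha> q" using False by (simp add: q_def scaleC_scaleC \<alpha>_def)
    then have "L x = scaleC (\<sigma> \<alpha>) (T e + V q)"
      by (simp add: L_def V_scaleC[OF q] scaleC_add_right flip: \<alpha>_def)
    moreover have "e + q = scaleC (inverse \<alpha>) x"
      using False by (simp add: q_def P_def scaleC_diff_right scaleC_scaleC \<alpha>_def)
    ultimately have "L x = scaleC (\<sigma> \<alpha> * cnj (k q)) (T (scaleC (inverse \<alpha>) x))"
      by (simp add: V_eq scaleC_scaleC)
    moreover obtain d where "T (scaleC (inverse \<alpha>) x) = scaleC d (T x)"
      using T_line[OF \<open>x \<noteq> 0\<close>] by blast
    ultimately show ?thesis by (auto simp: scaleC_scaleC)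
  qed
  have "semi_isometry L"
  proof (cases "s = \<i>")
    case True
    then have "linear_isometry L"
      by (simp add: linear_isometry_def clinear_map_def L_add L_scaleC L_norm \<sigma>_def)
    then show ?thesis by (simp add: semi_isometry_def)
  next
    case False
    then have "conj_linear_isometry L"
      by (simp add: conj_linear_isometry_def cconj_linear_map_def L_add L_scaleC L_norm \<sigma>_def)
    then show ?thesis by (simp add: semi_isometry_def)
  qed
  then show thesis using L_line that by blast
qed

lemma adjoin_Int_adjoin:
  assumes X: "csubspace X" and p: "p \<in> orth_compl X" and q: "q \<in> orth_compl X"
    and indep: "\<nexists>c. q = scaleC c p"
  shows "adjoin X p \<inter> adjoin X q = X"
proof
  show "X \<subseteq> adjoin X p \<inter> adjoin X q" using adjoin_superset by blast
  show "adjoin X p \<inter> adjoin X q \<subseteq> X"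
  proof
    fix y assume y: "y \<in> adjoin X p \<inter> adjoin X q"
    obtain x c where x: "x \<in> X" "y = x + scaleC c p" using y by (auto elim: adjoinE)
    obtain z d where z: "z \<in> X" "y = z + scaleC d q" using y by (auto elim: adjoinE)
    have eq: "x - z = scaleC d q - scaleC c p" using x(2) z(2) by (simp add: algebra_simps)
    have "x - z \<in> orth_compl X"
      unfolding eq by (intro csubspace_diff csubspace_scaleC csubspace_orth_compl p q)
    then have "cinner (x - z) (x - z) = 0"
      by (rule orth_complD) (rule csubspace_diff[OF X x(1) z(1)])
    then have dq: "scaleC d q = scaleC c p" using eq by simp
    have "d = 0"
    proof (rule ccontr)
      assume "d \<noteq> 0"
      then have "q = scaleC (inverse d * c) p"
        using arg_cong[OF dq, of "scaleC (inverse d)"] by (simp add: scaleC_scaleC)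
      then show False using indep by blast
    qed
    then show "y \<in> X" using z by simp
  qed
qed

section \<open>Preservation of angles between lines\<close>

context pair_preserver
begin

text \<open>For independent \<open>p\<close>, \<open>q\<close> the subspaces
  \<open>adjoin X p\<close> and \<open>adjoin X q\<close> meet in \<open>X\<close>, so the isometry
  of this pair carries \<open>X\<close> to \<open>f X\<close> and the lines of \<open>p\<close> and
  \<open>q\<close> to those of \<open>T p\<close> and \<open>T q\<close>, possibly exchanged. The
  modulus of \<open>cinner\<close> is symmetric, so an exchange does no harm.\<close>

lemma T_cinner: "cmod (cinner (T p) (T q)) = cmod (cinner p q)"
proof -
  obtain X where X: "X \<in> G_inf" "{p, q} \<subseteq> orth_compl X" using G_inf_avoiding[of "{p, q}"] by auto
  then have p: "p \<in> orth_compl X" and q: "q \<in> orth_compl X" by simp_all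
  note X' = G_inf_csubspace[OF X(1)] and fX = G_inf_csubspace[OF maps[OF X(1)]]
  note A = G_inf_adjoin[OF X(1) p] and B = G_inf_adjoin[OF X(1) q]
  note Tp = T_orth[OF X(1) p] and Tq = T_orth[OF X(1) q]
  note fA = f_adjoin[OF X(1) p] and fB = f_adjoin[OF X(1) q]
  consider "p = 0" | c where "q = scaleC c p" "c \<noteq> 0" | "q = 0" | "p \<noteq> 0" "\<nexists>c. q = scaleC c p"
    by (metis scaleC_0_left)
  then show ?thesis
  proof cases
    case 1
    then have "T p = 0" using T_norm[of p] by simp
    with 1 show ?thesis by simp
  next
    case 3
    then have "T q = 0" using T_norm[of q] by simp
    with 3 show ?thesis by simp
  next
    case (2 c)
    then have "adjoin X q = adjoin X p" by (simp add: adjoin_scaleC)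
    then have "T q \<in> adjoin (f X) (T p)"
      using fA fB mem_adjoin[OF csubspace_0[OF fX], of "T q"] by simp
    then obtain d where d: "T q = scaleC d (T p)" using adjoin_orth_unique[OF fX Tp Tq] by blast
    have "cmod (cinner (T p) (T q)) = norm (T p) * norm (T q)"
      unfolding d by (rule cmod_cinner_scaleC_self)
    also have "\<dots> = norm p * norm q" by (simp add: T_norm)
    also have "\<dots> = cmod (cinner p q)" unfolding 2 by (simp only: cmod_cinner_scaleC_self)
    finally show ?thesis .
  next
    case 4
    have "q \<noteq> 0" using 4(2) scaleC_0_left by metis
    \<comment> \<open>By injectivity of \<open>f\<close>; without it the images of the two subspaces
      might meet in more than \<open>f X\<close>.\<close>
    have "\<nexists>c. T q = scaleC c (T p)"
    proof
      assume "\<exists>c. T q = scaleC c (T p)"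
      then obtain c where c: "T q = scaleC c (T p)" ..
      have "c \<noteq> 0" using c T_norm[of q] \<open>q \<noteq> 0\<close> by auto
      then have "f (adjoin X q) = f (adjoin X p)" by (simp only: fA fB c adjoin_scaleC[OF \<open>c \<noteq> 0\<close>])
      then have "adjoin X q = adjoin X p" by (rule f_inj[OF B A])
      then have "q \<in> adjoin X p" using mem_adjoin[OF csubspace_0[OF X'], of q] by simp
      then show False using adjoin_orth_unique[OF X' p q] 4(2) by blast
    qed
    then have int: "f (adjoin X p) \<inter> f (adjoin X q) = f X"
      unfolding fA fB by (rule adjoin_Int_adjoin[OF fX Tp Tq])
    obtain L where L: "linear_isometry L"
      "f (adjoin X p) = L ` adjoin X p \<and> f (adjoin X q) = L ` adjoin X q \<or>
       f (adjoin X p) = L ` adjoin X q \<and> f (adjoin X q) = L ` adjoin X p"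
      using pairE[OF A B] .
    note L' = linear_isometry_semi[OF L(1)]
    have "f (adjoin X p) \<inter> f (adjoin X q) = L ` (adjoin X p \<inter> adjoin X q)"
      using L(2) image_Int[OF semi_isometry_inj[OF L']] by blast
    then have LX: "f X = L ` X"
      by (simp add: int adjoin_Int_adjoin[OF X' p q 4(2)])
    have line: "\<exists>c. t = scaleC c (L r)"
      if "r \<in> orth_compl X" "t \<in> orth_compl (f X)" "adjoin (f X) t = L ` adjoin X r" for r t
    proof (rule adjoin_orth_unique[OF fX])
      show "L r \<in> orth_compl (f X)"
        unfolding LX using image_subset_orth_compl_iff[OF L', of "{r}" X] that(1) by simp
      show "t \<in> adjoin (f X) (L r)"
        using mem_adjoin[OF csubspace_0[OF fX], of t] that(3) by (simp add: image_adjoin[OF L(1)] LX)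
    qed (rule that)
    obtain u v where "\<exists>a. T p = scaleC a (L u)" "\<exists>b. T q = scaleC b (L v)"
      and uv: "u = p \<and> v = q \<or> u = q \<and> v = p"
      using L(2) unfolding fA fB
    proof (elim disjE conjE)
      assume "adjoin (f X) (T p) = L ` adjoin X p" "adjoin (f X) (T q) = L ` adjoin X q"
      then show thesis using that[OF line[OF p Tp] line[OF q Tq]] by simp
    next
      assume "adjoin (f X) (T p) = L ` adjoin X q" "adjoin (f X) (T q) = L ` adjoin X p"
      then show thesis using that[OF line[OF q Tp] line[OF p Tq]] by simp
    qed
    then obtain a b where ab: "T p = scaleC a (L u)" "T q = scaleC b (L v)" by blast
    \<comment> \<open>After an exchange \<open>u\<close> is \<open>q\<close>, so \<open>a\<close>
      and \<open>b\<close> need not have modulus 1; only the product of their moduli is 1.\<close>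
    have "cmod a * norm u = norm p" "cmod b * norm v = norm q"
      using T_norm[of p] T_norm[of q] unfolding ab by (simp_all add: norm_scaleC semi_isometry_norm[OF L'])
    then have "(cmod a * cmod b) * (norm u * norm v) = norm p * norm q" by (simp add: ac_simps)
    moreover have "norm u * norm v = norm p * norm q" using uv by auto
    ultimately have one: "cmod a * cmod b = 1" using \<open>p \<noteq> 0\<close> \<open>q \<noteq> 0\<close> by simp
    have "cmod (cinner (T p) (T q)) = cmod a * cmod b * cmod (cinner u v)"
      unfolding ab by (simp add: norm_mult semi_isometry_cmod_cinner[OF L'])
    also have "\<dots> = cmod (cinner p q)"
      using uv one cinner_commute[of p q] by auto
    finally show ?thesis .
  qed
qed

end

section \<open>Remainders and components\<close>

text \<open>If the finite set \<open>F\<close> witnesses the failure for \<open>W\<close>, then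
  \<open>F\<close> with \<open>p\<close> added does so for \<open>adjoin W p\<close>, because
  orthogonality to \<open>p\<close> removes the new component.\<close>

lemma not_meets_fin_orth_adjoin:
  assumes "\<not> meets_fin_orth W" "p \<in> orth_compl W"
  shows "\<not> meets_fin_orth (adjoin W p)"
proof
  assume M: "meets_fin_orth (adjoin W p)"
  obtain F where F: "finite F" "\<And>w. w \<in> W \<Longrightarrow> \<forall>v\<in>F. cinner w v = 0 \<Longrightarrow> w = 0"
    using assms(1) unfolding meets_fin_orth_def by blast
  have "finite (insert p F)" using F(1) by simp
  then obtain y where y: "y \<in> adjoin W p" "y \<noteq> 0" "\<forall>v\<in>insert p F. cinner y v = 0"
    using M unfolding meets_fin_orth_def by meson
  obtain w c where w: "w \<in> W" "y = w + scaleC c p" using y(1) by (rule adjoinE)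
  have "cinner y p = c * cinner p p" using orth_complD[OF assms(2) w(1)] w(2) by (simp add: cinner_add_left)
  then have "y = w" using y(3) w(2) by auto
  then show False using F(2)[of w] w(1) y by simp
qed

text \<open>Induction on \<open>F\<close>: replacing a vector of \<open>F\<close> by its projection to \<open>X \<inter> orth_compl Z\<close> and
  adjoining the latter to \<open>Z\<close> makes that vector superfluous.\<close>

lemma finite_extension_induct:
  assumes "finite F" and X: "closed_csubspace X"
    and "closed_csubspace Z" "Z \<subseteq> X"
    and "\<And>w. w \<in> X \<Longrightarrow> w \<in> orth_compl Z \<Longrightarrow> \<forall>v\<in>F. cinner w v = 0 \<Longrightarrow> w = 0"
    and "P Z"
    and step: "\<And>W p. W \<subseteq> X \<Longrightarrow> p \<in> orth_compl W \<Longrightarrow> P W \<Longrightarrow> P (adjoin W p)"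
  shows "P X"
  using assms(1,3-6)
proof (induction F arbitrary: Z)
  case (empty Z)
  have "X \<subseteq> Z"
  proof
    fix x assume x: "x \<in> X"
    obtain z where z: "z \<in> Z" "x - z \<in> orth_compl Z" using projection_exists[OF empty.prems(1)] .
    have "x - z \<in> X"
      using csubspace_diff[OF closed_csubspace_csubspace[OF X] x] z(1) empty.prems(2) by blast
    then have "x - z = 0" using empty.prems(3)[OF _ z(2)] by simp
    then show "x \<in> Z" using z(1) by simp
  qed
  then show ?case using empty.prems(2,4) by (simp add: subset_antisym)
next
  case (insert \<phi> F Z)
  let ?U = "X \<inter> orth_compl Z"
  obtain s where s: "s \<in> ?U" "\<phi> - s \<in> orth_compl ?U"
    using projection_exists[OF closed_csubspace_Int[OF X closed_csubspace_orth_compl]] .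
  show ?case
  proof (rule insert.IH[of "adjoin Z s"])
    show "closed_csubspace (adjoin Z s)" using closed_csubspace_adjoin[OF insert.prems(1)] s(1) by simp
    show "adjoin Z s \<subseteq> X"
      using adjoin_subset[OF closed_csubspace_csubspace[OF X] insert.prems(2)] s(1) by simp
    show "P (adjoin Z s)" using step[OF insert.prems(2) _ insert.prems(4)] s(1) by simp
    fix w assume w: "w \<in> X" "w \<in> orth_compl (adjoin Z s)" "\<forall>v\<in>F. cinner w v = 0"
    then have wZ: "w \<in> orth_compl Z" "w \<in> orth_compl {s}"
      using orth_compl_adjoin[OF closed_csubspace_csubspace[OF insert.prems(1)], of s] by simp_all
    have "cinner w (\<phi> - s) = 0" using orth_complD[OF s(2), of w] w(1) wZ(1) by simp
    moreover have "cinner w s = 0" using orth_complD'[OF wZ(2)] by simp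
    ultimately have "cinner w \<phi> = 0" by (simp add: cinner_diff_right)
    then show "w = 0" using insert.prems(3)[OF w(1) wZ(1)] w(3) by simp
  qed
qed

lemma same_component_commute: "same_component X Y \<longleftrightarrow> same_component Y X"
  by (auto simp: same_component_def Int_commute)

lemma same_component_finite:
  assumes "same_component X Y"
  shows "\<exists>F. finite F \<and> (\<forall>w\<in>X \<inter> orth_compl (X \<inter> Y). (\<forall>v\<in>F. cinner w v = 0) \<longrightarrow> w = 0)"
proof -
  have "\<not> infinite_cdim (X \<inter> orth_compl (X \<inter> Y))"
    using assms by (simp add: same_component_def finite_codim_in_def)
  then have "\<not> meets_fin_orth (X \<inter> orth_compl (X \<inter> Y))"
    using meets_fin_orth_infinite_cdim by blast
  then show ?thesis unfolding meets_fin_orth_def by blast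
qed

text \<open>The point is infinite dimension of the intersection: a failure would persist through the
  finitely many adjunctions leading from \<open>X \<inter> Y\<close> up to \<open>X\<close>.\<close>

lemma same_component_Int_G_inf:
  assumes X: "X \<in> G_inf" and Y: "Y \<in> G_inf" and XY: "same_component X Y"
  shows "X \<inter> Y \<in> G_inf"
proof (rule G_infI)
  show c: "closed_csubspace (X \<inter> Y)" by (rule closed_csubspace_Int[OF G_inf_closed[OF X] G_inf_closed[OF Y]])
  show "meets_fin_orth (orth_compl (X \<inter> Y))"
    by (rule meets_fin_orth_mono[OF G_inf_orth_meets[OF X]]) (simp add: orth_compl_antimono)
  obtain F where F: "finite F" "\<And>w. w \<in> X \<Longrightarrow> w \<in> orth_compl (X \<inter> Y) \<Longrightarrow> \<forall>v\<in>F. cinner w v = 0 \<Longrightarrow> w = 0"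
    using same_component_finite[OF XY] by blast
  show "meets_fin_orth (X \<inter> Y)"
  proof (rule ccontr)
    assume "\<not> meets_fin_orth (X \<inter> Y)"
    then have "\<not> meets_fin_orth X"
      using finite_extension_induct[OF F(1) G_inf_closed[OF X] c Int_lower1 F(2), of "\<lambda>W. \<not> meets_fin_orth W"]
        not_meets_fin_orth_adjoin by blast
    then show False using G_inf_meets[OF X] by simp
  qed
qed

text \<open>Compare coefficients at \<open>p + q\<close>: since \<open>L p\<close> and
  \<open>L q\<close> are orthogonal, \<open>a\<close> and \<open>b\<close> both equal the factor
  there.\<close>

lemma semi_isometry_collinear_orthogonal:
  assumes L: "semi_isometry L" and L': "semi_isometry L'"
    and col: "\<And>x. \<exists>c. L' x = scaleC c (L x)"
    and pq: "cinner p q = 0" "p \<noteq> 0" "q \<noteq> 0"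
    and ab: "L' p = scaleC a (L p)" "L' q = scaleC b (L q)"
  shows "a = b"
proof -
  obtain c where c: "L' (p + q) = scaleC c (L (p + q))" using col by blast
  have L0: "L p \<noteq> 0" "L q \<noteq> 0"
    using semi_isometry_norm[OF L, of p] semi_isometry_norm[OF L, of q] pq by auto
  have orth: "cinner (L q) (L p) = 0" "cinner (L p) (L q) = 0"
    using pq(1) cinner_eq_0_commute[of p q] by (simp_all add: semi_isometry_orth[OF L])
  have eq: "scaleC a (L p) + scaleC b (L q) = scaleC c (L p) + scaleC c (L q)"
    using c by (simp add: semi_isometry_add[OF L] semi_isometry_add[OF L'] ab scaleC_add_right)
  have "a * cinner (L p) (L p) = c * cinner (L p) (L p)"
    using arg_cong[OF eq, of "\<lambda>x. cinner x (L p)"] by (simp add: cinner_add_left orth)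
  moreover have "b * cinner (L q) (L q) = c * cinner (L q) (L q)"
    using arg_cong[OF eq, of "\<lambda>x. cinner x (L q)"] by (simp add: cinner_add_left orth)
  ultimately show ?thesis using L0 by simp
qed

text \<open>Two given vectors need not be orthogonal, but infinite dimension supplies a third one
  orthogonal to both, through which their factors agree.\<close>

lemma semi_isometry_collinear:
  fixes L L' :: "'a::complex_hilbert \<Rightarrow> 'a"
  assumes inf: "meets_fin_orth (UNIV :: 'a set)"
    and L: "semi_isometry L" and L': "semi_isometry L'"
    and col: "\<And>x. \<exists>c. L' x = scaleC c (L x)"
  shows "\<exists>c. L' = (\<lambda>x. scaleC c (L x))"
proof -
  obtain k where k: "\<And>x. L' x = scaleC (k x) (L x)" using col by metis
  note const = semi_isometry_collinear_orthogonal[OF L L' col _ _ _ k k]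
  obtain e :: 'a where e: "e \<noteq> 0" using inf unfolding meets_fin_orth_def by (meson finite.emptyI)
  have "L' x = scaleC (k e) (L x)" for x
  proof (cases "x = 0")
    case True
    then show ?thesis by (simp add: semi_isometry_0[OF L] semi_isometry_0[OF L'])
  next
    case False
    have "finite {x, e}" by simp
    then obtain r where "r \<noteq> 0" "\<forall>v\<in>{x, e}. cinner r v = 0"
      using inf unfolding meets_fin_orth_def by meson
    then have "k r = k x" "k r = k e" using const[of r x] const[of r e] False e by simp_all
    then show ?thesis using k[of x] by simp
  qed
  then show ?thesis by blast
qed

section \<open>Decomposition of \<open>f X\<close> and uniqueness of the isometry\<close>

context pair_preserver
begin

lemma meets_UNIV: "meets_fin_orth (UNIV :: 'a set)"
  by (rule infinite_cdim_meets_fin_orth[OF closed_csubspace_csubspace[OF closed_csubspace_UNIV] infinite_UNIV])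

text \<open>The remainder is orthogonal to the range of \<open>L\<close>, so \<open>L p\<close> is
  orthogonal to \<open>f X\<close>; yet it lies in \<open>f (adjoin X p)\<close>, which pins it to
  the line of \<open>T p\<close>. Uniqueness of the isometry rests on this.\<close>

lemma represents_T_line:
  assumes L: "semi_isometry L" and rep: "represents f L O'"
  shows "\<exists>c. L p = scaleC c (T p)"
proof -
  obtain X where X: "X \<in> G_inf" "{p} \<subseteq> orth_compl X" using G_inf_avoiding[of "{p}"] by auto
  then have p: "p \<in> orth_compl X" by simp
  note A = G_inf_adjoin[OF X(1) p]
  have rep': "closed_csubspace (O' Y)" "\<And>u v. u \<in> range L \<Longrightarrow> v \<in> O' Y \<Longrightarrow> cinner u v = 0"
    "f Y = {u + v | u v. u \<in> L ` Y \<and> v \<in> O' Y}" if "Y \<in> G_inf" for Y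
    using rep that by (auto simp: represents_def)
  have "p \<in> adjoin X p" using mem_adjoin[OF csubspace_0[OF G_inf_csubspace[OF X(1)]]] .
  moreover have "0 \<in> O' (adjoin X p)" using csubspace_0[OF closed_csubspace_csubspace[OF rep'(1)[OF A]]] .
  ultimately have "L p + 0 \<in> f (adjoin X p)" unfolding rep'(3)[OF A] by blast
  then have Lp: "L p \<in> adjoin (f X) (T p)" by (simp add: f_adjoin[OF X(1) p])
  have "L p \<in> orth_compl (f X)"
  proof (rule orth_complI)
    fix y assume "y \<in> f X"
    then obtain x v where x: "x \<in> X" "v \<in> O' X" "y = L x + v" unfolding rep'(3)[OF X(1)] by blast
    then show "cinner (L p) y = 0"
      using rep'(2)[OF X(1) rangeI x(2)] orth_complD'[OF p x(1)]
      by (simp add: cinner_add_right semi_isometry_orth[OF L])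
  qed
  then show ?thesis using adjoin_orth_unique[OF G_inf_csubspace[OF maps[OF X(1)]] T_orth[OF X(1) p] _ Lp] by blast
qed

context
  fixes L
  assumes L: "semi_isometry L" and LT: "\<And>p. \<exists>c. L p = scaleC c (T p)"
begin

text \<open>The decomposition leaves no other choice: if \<open>L x + v\<close>, with
  \<open>v\<close> orthogonal to the range, is itself orthogonal to the range, then
  \<open>L x = 0\<close>.\<close>

definition rest :: "'a set \<Rightarrow> 'a set" where
  "rest X = f X \<inter> orth_compl (range L)"

lemma T_line_L:
  obtains c where "T p = scaleC c (L p)"
proof -
  obtain c where c: "L p = scaleC c (T p)" using LT by blast
  show thesis
  proof (cases "c = 0")
    case True
    then have "T p = 0" using c semi_isometry_norm[OF L, of p] T_norm[of p] by simp
    then show ?thesis using that[of 0] by simp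
  next
    case False
    then show ?thesis using that[of "inverse c"] c by (simp add: scaleC_scaleC)
  qed
qed

lemma L_mem:
  assumes "X \<in> G_inf" "p \<in> X" shows "L p \<in> f X"
proof -
  obtain c where "L p = scaleC c (T p)" using LT by blast
  then show ?thesis using csubspace_scaleC[OF G_inf_csubspace[OF maps[OF assms(1)]] T_mem[OF assms]] by simp
qed

lemma L_orth:
  assumes "X \<in> G_inf" "p \<in> orth_compl X" shows "L p \<in> orth_compl (f X)"
proof -
  obtain c where "L p = scaleC c (T p)" using LT by blast
  then show ?thesis using csubspace_scaleC[OF csubspace_orth_compl T_orth[OF assms]] by simp
qed

lemma represents_rest: "represents f L rest"
  unfolding represents_def
proof (intro ballI conjI)
  fix X :: "'a set" assume X: "X \<in> G_inf"
  note fX = G_inf_csubspace[OF maps[OF X]]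
  show "closed_csubspace (rest X)"
    unfolding rest_def by (intro closed_csubspace_Int closed_csubspace_orth_compl G_inf_closed maps X)
  show "cinner u v = 0" if "u \<in> range L" "v \<in> rest X" for u v
    using that orth_complD[of v "range L" u] by (simp add: rest_def)
  show "f X = {u + v | u v. u \<in> L ` X \<and> v \<in> rest X}"
  proof
    show "{u + v | u v. u \<in> L ` X \<and> v \<in> rest X} \<subseteq> f X"
      using csubspace_add[OF fX] L_mem[OF X] by (auto simp: rest_def)
    show "f X \<subseteq> {u + v | u v. u \<in> L ` X \<and> v \<in> rest X}"
    proof
      fix y assume y: "y \<in> f X"
      obtain s where s: "s \<in> L ` X" "y - s \<in> orth_compl (L ` X)"
        using projection_exists[OF closed_csubspace_image[OF L G_inf_closed[OF X]]] .
      have "s \<in> f X" using s(1) L_mem[OF X] by blast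
      then have w: "y - s \<in> f X" using csubspace_diff[OF fX y] by simp
      \<comment> \<open>Split \<open>x\<close> along \<open>X\<close> and its complement: the choice
        of \<open>s\<close> deals with \<open>L z\<close>, and \<open>L (x - z)\<close> is
        orthogonal to all of \<open>f X\<close>.\<close>
      have "cinner (y - s) (L x) = 0" for x
      proof -
        obtain z where z: "z \<in> X" "x - z \<in> orth_compl X" using projection_exists[OF G_inf_closed[OF X]] .
        have "cinner (y - s) (L z) = 0" using orth_complD'[OF s(2)] z(1) by blast
        moreover have "cinner (y - s) (L (x - z)) = 0" by (rule orth_complD[OF L_orth[OF X z(2)] w])
        ultimately show ?thesis by (simp add: semi_isometry_diff[OF L] cinner_diff_right)
      qed
      then have "y - s \<in> orth_compl (range L)" by (intro orth_complI) auto
      then have "y - s \<in> rest X" using w by (simp add: rest_def)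
      moreover have "y = s + (y - s)" by simp
      ultimately show "y \<in> {u + v | u v. u \<in> L ` X \<and> v \<in> rest X}" using s(1) by blast
    qed
  qed
qed

lemma rest_mono: "X \<in> G_inf \<Longrightarrow> Y \<in> G_inf \<Longrightarrow> Y \<subseteq> X \<Longrightarrow> rest Y \<subseteq> rest X"
  using f_mono[of X Y] by (auto simp: rest_def)

text \<open>The line by which \<open>f X\<close> grows is spanned by a multiple of
  \<open>L p\<close>. It lies in the range of \<open>L\<close> and contributes nothing orthogonal to
  that range.\<close>

lemma rest_adjoin:
  assumes X: "X \<in> G_inf" and p: "p \<in> orth_compl X"
  shows "rest (adjoin X p) = rest X"
proof
  show "rest X \<subseteq> rest (adjoin X p)"
    by (rule rest_mono[OF G_inf_adjoin[OF X p] X adjoin_superset])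
  show "rest (adjoin X p) \<subseteq> rest X"
  proof
    fix v assume "v \<in> rest (adjoin X p)"
    then have v: "v \<in> adjoin (f X) (T p)" "v \<in> orth_compl (range L)"
      by (simp_all add: rest_def f_adjoin[OF X p])
    obtain y c where y: "y \<in> f X" "v = y + scaleC c (T p)" using v(1) by (rule adjoinE)
    obtain d where d: "T p = scaleC d (L p)" by (rule T_line_L)
    have "cinner v (T p) = 0" using orth_complD'[OF v(2) rangeI[of L p]] by (simp add: d)
    moreover have "cinner y (T p) = 0" by (rule orth_complD[OF T_orth[OF X p] y(1)])
    ultimately have "scaleC c (T p) = 0" using y(2) by (auto simp: cinner_add_left)
    then have "v = y" unfolding y(2) by (simp only: add_0_right)
    then show "v \<in> rest X" using v(2) y(1) by (simp add: rest_def)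
  qed
qed

lemma rest_component:
  assumes X: "X \<in> G_inf" and Y: "Y \<in> G_inf" and XY: "same_component X Y"
  shows "rest X = rest (X \<inter> Y)"
proof -
  note XY' = same_component_Int_G_inf[OF assms]
  obtain F where F: "finite F" "\<And>w. w \<in> X \<Longrightarrow> w \<in> orth_compl (X \<inter> Y) \<Longrightarrow> \<forall>v\<in>F. cinner w v = 0 \<Longrightarrow> w = 0"
    using same_component_finite[OF XY] by blast
  \<comment> \<open>Membership in \<open>G_inf\<close> is carried through the induction because each
    adjunction step requires it of the smaller subspace.\<close>
  have "X \<in> G_inf \<and> rest X = rest (X \<inter> Y)"
    by (rule finite_extension_induct[OF F(1) G_inf_closed[OF X] G_inf_closed[OF XY'] Int_lower1 F(2),
          where P = "\<lambda>W. W \<in> G_inf \<and> rest W = rest (X \<inter> Y)"])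
       (simp_all add: XY' G_inf_adjoin rest_adjoin)
  then show ?thesis by simp
qed

end

end

theorem theorem1:
  fixes f :: "'a::complex_hilbert set \<Rightarrow> 'a set"
  assumes "infinite_cdim (UNIV :: 'a set)"
    and "\<forall>X\<in>G_inf. f X \<in> G_inf"
    and "preserves_pair_equivalence f"
  shows "\<exists>L Ofn. (linear_isometry L \<or> conj_linear_isometry L) \<and> represents f L Ofn \<and>
           (\<forall>L' Ofn'. (linear_isometry L' \<or> conj_linear_isometry L') \<and> represents f L' Ofn'
                \<longrightarrow> (\<exists>c::complex. L' = (\<lambda>x. scaleC c (L x)))) \<and>
           (\<forall>X\<in>G_inf. \<forall>Y\<in>G_inf. same_component X Y \<longrightarrow> Ofn X = Ofn Y) \<and>
           (\<forall>X\<in>G_inf. \<forall>Y\<in>G_inf. Y \<subseteq> X \<longrightarrow> Ofn Y \<subseteq> Ofn X)"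
proof -
  interpret pair_preserver f using assms by unfold_locales auto
  obtain w :: 'a where "w \<noteq> 0" using infinite_cdim_nonzero[OF assms(1)] by blast
  then have "norm (scaleC (of_real (inverse (norm w))) w) = 1"
    by (simp add: norm_scaleC norm_inverse)
  then obtain L where L: "semi_isometry L" and LT: "\<And>p. \<exists>c. L p = scaleC c (T p)"
    using wigner[of T, OF T_cinner] by blast
  \<comment> \<open>Both \<open>L\<close> and \<open>L'\<close> take values on the lines given by
    \<open>T\<close>, so they are collinear at every point, even if one were linear and the other
    conjugate linear.\<close>
  have unique: "\<exists>c. L' = (\<lambda>x. scaleC c (L x))" if L': "semi_isometry L'" "represents f L' O'" for L' O'
  proof (rule semi_isometry_collinear[OF meets_UNIV L L'(1)])
    fix x
    obtain c where "T x = scaleC c (L x)" by (rule T_line_L[OF L LT])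
    moreover obtain d where "L' x = scaleC d (T x)" using represents_T_line[OF L'] by blast
    ultimately show "\<exists>c. L' x = scaleC c (L x)" by (auto simp: scaleC_scaleC)
  qed
  have component: "rest L X = rest L Y" if "X \<in> G_inf" "Y \<in> G_inf" "same_component X Y" for X Y
    using rest_component[OF L LT that] rest_component[OF L LT that(2,1)] that(3) same_component_commute[of X Y]
    by (simp add: Int_commute)
  show ?thesis
  proof (intro exI[of _ L] exI[of _ "rest L"] conjI allI impI ballI)
    show "linear_isometry L \<or> conj_linear_isometry L" using L by (simp add: semi_isometry_def)
    show "represents f L (rest L)" by (rule represents_rest[OF L LT])
    show "\<exists>c. L' = (\<lambda>x. scaleC c (L x))"
      if "(linear_isometry L' \<or> conj_linear_isometry L') \<and> represents f L' O'" for L' O'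
      using unique[of L' O'] that by (simp add: semi_isometry_def)
    show "rest L X = rest L Y" if "X \<in> G_inf" "Y \<in> G_inf" "same_component X Y" for X Y
      by (rule component[OF that])
    show "rest L Y \<subseteq> rest L X" if "X \<in> G_inf" "Y \<in> G_inf" "Y \<subseteq> X" for X Y
      by (rule rest_mono[OF L LT that])
  qed
qed

end
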